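(* Let $\mathcal{S}=(P,N)$ be a sample of CGSs and let ATL' be a fragment of ATL, i.e. $\mathrm{ATL}'=\mathbf{ATL}(\mathsf{O})$ for some $\mathsf{O}\subseteq\{\neg,\wedge,\mathbf{X},\mathbf{G},\mathbf{U}\}$. It can be decided in time exponential in $|\mathcal{S}|$ whether there exists an ATL' formula consistent with $\mathcal{S}$. Moreover, if there is one, then there is an ATL' formula consistent with $\mathcal{S}$ of size at most $2^{|Q|}$.
   Context: A concurrent game structure (CGS) is a tuple $C=\langle Q,I,k,\mathcal{P},\pi,d,\delta\rangle$: finite states $Q$, initial states $I\subseteq Q$, agents $\mathsf{Ag}=\{1,\dots,k\}$, finite propositions $\mathcal{P}$, labelling $\pi:Q\to2^{\mathcal{P}}$, action counts $d:Q\times\mathsf{Ag}\to\mathbb{N}_{\ge1}$, transition function $\delta$ mapping each $(q,\alpha_1,\dots,\alpha_k)$ with $\alpha_a\le d(q,a)$ to a state; $Q_{\mathsf{Act}}$ is the set of all such tuples $(q,\alpha_1,\dots,\alpha_k)$, and $|C|=|Q_{\mathsf{Act}}|+|\mathcal{P}|+|\mathsf{Ag}|$. Strategies, outcomes and the semantics of ATL are standard: state formulas $\Phi::=p\mid\neg\Phi\mid\Phi\wedge\Phi\mid\langle\langle A\rangle\rangle\mathbf{X}\Phi\mid\langle\langle A\rangle\rangle\mathbf{G}\Phi\mid\langle\langle A\rangle\rangle(\Phi\,\mathbf{U}\,\Phi)$, $A\subseteq\mathsf{Ag}$, where $q\models\langle\langle A\rangle\rangle\varphi$ iff there is a strategy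 profile for the agents of $A$ (strategies being maps from finite histories to available actions) such that every infinite play from $q$ consistent with it satisfies $\varphi$. $C\models\Phi$ iff all initial states of $C$ satisfy $\Phi$. The size $|\Phi|$ of a formula is the number of its distinct subformulas (each of $\langle\langle A\rangle\rangle\mathbf{X}\Phi'$, $\langle\langle A\rangle\rangle\mathbf{G}\Phi'$, $\langle\langle A\rangle\rangle(\Phi_1\mathbf{U}\Phi_2)$ counting as one subformula besides those of its arguments). $\mathbf{ATL}(\mathsf{O})$ is the set of ATL formulas using only operators in $\mathsf{O}$ (propositions always allowed). A sample $\mathcal{S}=(P,N)$ is a pair of finite sets of CGSs with common agent set; $|\mathcal{S}|=\sum_{C\in P\cup N}|C|$; $Q$ is the disjoint union of the state sets of all CGSs of the sample. $\Phi$ is consistent with $\mathcal{S}$ if $C\models\Phi$ for all $C\in P$ and $C\not\models\Phi$ for all $C\in N$. *)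

theory Defs
  imports "HOL-Library.FuncSet"
begin

section \<open>Concurrent game structures\<close>

text \<open>
  States and propositions are named by natural numbers; the agents are \<open>1, \<dots>, nagents C\<close>.
  An action tuple \<open>(\<alpha>\<^sub>1, \<dots>, \<alpha>\<^sub>k)\<close> is a list, so the action of agent \<open>a\<close> is \<open>\<alpha> ! (a - 1)\<close>.
\<close>

record cgs =
  states :: "nat set"
  inits :: "nat set"
  nagents :: nat
  props :: "nat set"
  label :: "nat \<Rightarrow> nat set"
  nact :: "nat \<times> nat \<Rightarrow> nat"
  step :: "nat \<times> nat list \<Rightarrow> nat"

definition agents :: "cgs \<Rightarrow> nat set" where
  "agents C = {1..nagents C}"

definition act :: "nat list \<Rightarrow> nat \<Rightarrow> nat" where
  "act \<alpha> a = \<alpha> ! (a - 1)"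

definition moves :: "cgs \<Rightarrow> nat \<Rightarrow> nat list set" where
  "moves C q = {\<alpha>. length \<alpha> = nagents C \<and> (\<forall>a\<in>agents C. act \<alpha> a \<in> {1..nact C (q, a)})}"

definition Q_Act :: "cgs \<Rightarrow> (nat \<times> nat list) set" where
  "Q_Act C = (SIGMA q:states C. moves C q)"

text \<open>
  The extensional function space \<open>\<rightarrow>\<^sub>E\<close> makes two structures equal as records iff they are
  equal as tuples, so that sets of structures contain no spurious copies.
\<close>

definition is_cgs :: "cgs \<Rightarrow> bool" where
  "is_cgs C \<longleftrightarrow>
     finite (states C) \<and> inits C \<subseteq> states C \<and> finite (props C) \<and>
     label C \<in> states C \<rightarrow>\<^sub>E Pow (props C) \<and>
     nact C \<in> states C \<times> agents C \<rightarrow>\<^sub>E {1..} \<and>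
     step C \<in> Q_Act C \<rightarrow>\<^sub>E states C"

definition cgs_size :: "cgs \<Rightarrow> nat" where
  "cgs_size C = card (Q_Act C) + card (props C) + card (agents C)"


section \<open>ATL\<close>

datatype atl =
    Prop nat
  | Neg atl
  | Conj atl atl
  | EnfX "nat set" atl
  | EnfG "nat set" atl
  | EnfU "nat set" atl atl

text \<open>
  A strategy of agent \<open>a\<close> maps a finite history (a nonempty list of states, the current state
  being the last one) to an available action; a profile \<open>\<sigma>\<close> for the coalition \<open>A\<close> gives one
  strategy \<open>\<sigma> a\<close> for each \<open>a \<in> A\<close> (its values outside \<open>A\<close> are irrelevant).
\<close>

definition strategy_profile :: "cgs \<Rightarrow> nat set \<Rightarrow> (nat \<Rightarrow> nat list \<Rightarrow> nat) \<Rightarrow> bool" where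
  "strategy_profile C A \<sigma> \<longleftrightarrow>
     (\<forall>a\<in>A. \<forall>h. h \<noteq> [] \<and> set h \<subseteq> states C \<longrightarrow> \<sigma> a h \<in> {1..nact C (last h, a)})"

definition outcomes ::
  "cgs \<Rightarrow> nat set \<Rightarrow> (nat \<Rightarrow> nat list \<Rightarrow> nat) \<Rightarrow> nat \<Rightarrow> (nat \<Rightarrow> nat) set" where
  "outcomes C A \<sigma> q =
     {\<rho>. \<rho> 0 = q \<and>
         (\<forall>i. \<exists>\<alpha>\<in>moves C (\<rho> i).
            (\<forall>a\<in>A. act \<alpha> a = \<sigma> a (map \<rho> [0..<Suc i])) \<and> \<rho> (Suc i) = step C (\<rho> i, \<alpha>))}"

definition can_enforce :: "cgs \<Rightarrow> nat set \<Rightarrow> nat \<Rightarrow> ((nat \<Rightarrow> nat) \<Rightarrow> bool) \<Rightarrow> bool" where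
  "can_enforce C A q W \<longleftrightarrow> (\<exists>\<sigma>. strategy_profile C A \<sigma> \<and> (\<forall>\<rho>\<in>outcomes C A \<sigma> q. W \<rho>))"

primrec sat :: "cgs \<Rightarrow> atl \<Rightarrow> nat \<Rightarrow> bool" where
  "sat C (Prop p) = (\<lambda>q. p \<in> label C q)"
| "sat C (Neg \<Phi>) = (\<lambda>q. \<not> sat C \<Phi> q)"
| "sat C (Conj \<Phi> \<Psi>) = (\<lambda>q. sat C \<Phi> q \<and> sat C \<Psi> q)"
| "sat C (EnfX A \<Phi>) = (\<lambda>q. can_enforce C A q (\<lambda>\<rho>. sat C \<Phi> (\<rho> 1)))"
| "sat C (EnfG A \<Phi>) = (\<lambda>q. can_enforce C A q (\<lambda>\<rho>. \<forall>i. sat C \<Phi> (\<rho> i)))"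
| "sat C (EnfU A \<Phi> \<Psi>) = (\<lambda>q. can_enforce C A q (\<lambda>\<rho>. \<exists>i. sat C \<Psi> (\<rho> i) \<and> (\<forall>j<i. sat C \<Phi> (\<rho> j))))"

definition models :: "cgs \<Rightarrow> atl \<Rightarrow> bool" where
  "models C \<Phi> \<longleftrightarrow> (\<forall>q\<in>inits C. sat C \<Phi> q)"

primrec subformulas :: "atl \<Rightarrow> atl set" where
  "subformulas (Prop p) = {Prop p}"
| "subformulas (Neg \<Phi>) = insert (Neg \<Phi>) (subformulas \<Phi>)"
| "subformulas (Conj \<Phi> \<Psi>) = insert (Conj \<Phi> \<Psi>) (subformulas \<Phi> \<union> subformulas \<Psi>)"
| "subformulas (EnfX A \<Phi>) = insert (EnfX A \<Phi>) (subformulas \<Phi>)"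
| "subformulas (EnfG A \<Phi>) = insert (EnfG A \<Phi>) (subformulas \<Phi>)"
| "subformulas (EnfU A \<Phi> \<Psi>) = insert (EnfU A \<Phi> \<Psi>) (subformulas \<Phi> \<union> subformulas \<Psi>)"

definition formula_size :: "atl \<Rightarrow> nat" where
  "formula_size \<Phi> = card (subformulas \<Phi>)"

datatype atl_op = OpNot | OpAnd | OpX | OpG | OpU

inductive_set ATL :: "atl_op set \<Rightarrow> nat set \<Rightarrow> nat set \<Rightarrow> atl set"
  for Ops :: "atl_op set" and Ag :: "nat set" and AP :: "nat set" where
  "p \<in> AP \<Longrightarrow> Prop p \<in> ATL Ops Ag AP"
| "\<lbrakk>OpNot \<in> Ops; \<Phi> \<in> ATL Ops Ag AP\<rbrakk> \<Longrightarrow> Neg \<Phi> \<in> ATL Ops Ag AP"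
| "\<lbrakk>OpAnd \<in> Ops; \<Phi> \<in> ATL Ops Ag AP; \<Psi> \<in> ATL Ops Ag AP\<rbrakk> \<Longrightarrow> Conj \<Phi> \<Psi> \<in> ATL Ops Ag AP"
| "\<lbrakk>OpX \<in> Ops; A \<subseteq> Ag; \<Phi> \<in> ATL Ops Ag AP\<rbrakk> \<Longrightarrow> EnfX A \<Phi> \<in> ATL Ops Ag AP"
| "\<lbrakk>OpG \<in> Ops; A \<subseteq> Ag; \<Phi> \<in> ATL Ops Ag AP\<rbrakk> \<Longrightarrow> EnfG A \<Phi> \<in> ATL Ops Ag AP"
| "\<lbrakk>OpU \<in> Ops; A \<subseteq> Ag; \<Phi> \<in> ATL Ops Ag AP; \<Psi> \<in> ATL Ops Ag AP\<rbrakk> \<Longrightarrow> EnfU A \<Phi> \<Psi> \<in> ATL Ops Ag AP"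


section \<open>Samples\<close>

type_synonym sample = "cgs set \<times> cgs set"

fun all_cgs :: "sample \<Rightarrow> cgs set" where
  "all_cgs (P, N) = P \<union> N"

definition is_sample :: "sample \<Rightarrow> bool" where
  "is_sample S \<longleftrightarrow>
     finite (all_cgs S) \<and> (\<forall>C\<in>all_cgs S. is_cgs C) \<and>
     (\<forall>C\<in>all_cgs S. \<forall>C'\<in>all_cgs S. agents C = agents C')"

definition sample_agents :: "sample \<Rightarrow> nat set" where
  "sample_agents S = (\<Union>C\<in>all_cgs S. agents C)"

text \<open>
  The structures need not share their propositions: formulas range over all propositions of the
  sample, and a proposition that a structure does not have labels none of its states.
\<close>

definition sample_props :: "sample \<Rightarrow> nat set" where
  "sample_props S = (\<Union>C\<in>all_cgs S. props C)"

definition sample_size :: "sample \<Rightarrow> nat" where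
  "sample_size S = (\<Sum>C\<in>all_cgs S. cgs_size C)"

definition sample_states :: "sample \<Rightarrow> (cgs \<times> nat) set" where
  "sample_states S = (SIGMA C:all_cgs S. states C)"

fun consistent :: "atl \<Rightarrow> sample \<Rightarrow> bool" where
  "consistent \<Phi> (P, N) \<longleftrightarrow> (\<forall>C\<in>P. models C \<Phi>) \<and> (\<forall>C\<in>N. \<not> models C \<Phi>)"

definition sample_ATL :: "atl_op set \<Rightarrow> sample \<Rightarrow> atl set" where
  "sample_ATL Ops S = ATL Ops (sample_agents S) (sample_props S)"


section \<open>Computation model\<close>

text \<open>
  A first-order LISP on binary trees, in the style of N. D. Jones, \<^emph>\<open>Computability and
  Complexity from a Programming Perspective\<close>. A program is a finite list of function bodies,
  \<open>Arg i\<close> is the \<open>i\<close>-th argument of the current call, and every evaluated expression node costs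
  one time unit. Evaluation can be implemented with pointers, each unit taking a bounded number
  of pointer operations and allocating a bounded number of cells; trees are never compared,
  only tested for being a leaf. So this model and multi-tape Turing machines simulate each
  other with polynomial overhead.
\<close>

datatype tree = Leaf | Node tree tree

primrec left :: "tree \<Rightarrow> tree" where
  "left Leaf = Leaf"
| "left (Node l r) = l"

primrec right :: "tree \<Rightarrow> tree" where
  "right Leaf = Leaf"
| "right (Node l r) = r"

datatype expr =
    Arg nat
  | LeafE
  | NodeE expr expr
  | LeftE expr
  | RightE expr
  | IfLeaf expr expr expr
  | Call nat "expr list"

type_synonym program = "expr list"

text \<open>
  \<open>eval prog env e v t\<close>: with arguments \<open>env\<close>, the expression \<open>e\<close> evaluates to \<open>v\<close> in time \<open>t\<close>.
\<close>

inductive eval :: "program \<Rightarrow> tree list \<Rightarrow> expr \<Rightarrow> tree \<Rightarrow> nat \<Rightarrow> bool"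
  and evals :: "program \<Rightarrow> tree list \<Rightarrow> expr list \<Rightarrow> tree list \<Rightarrow> nat \<Rightarrow> bool"
  for prog :: program where
  eval_Arg: "i < length env \<Longrightarrow> eval prog env (Arg i) (env ! i) 1"
| eval_LeafE: "eval prog env LeafE Leaf 1"
| eval_NodeE: "\<lbrakk>eval prog env e1 v1 t1; eval prog env e2 v2 t2\<rbrakk>
    \<Longrightarrow> eval prog env (NodeE e1 e2) (Node v1 v2) (t1 + t2 + 1)"
| eval_LeftE: "eval prog env e v t \<Longrightarrow> eval prog env (LeftE e) (left v) (t + 1)"
| eval_RightE: "eval prog env e v t \<Longrightarrow> eval prog env (RightE e) (right v) (t + 1)"
| eval_IfLeaf_True: "\<lbrakk>eval prog env e Leaf t; eval prog env e1 v t1\<rbrakk>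
    \<Longrightarrow> eval prog env (IfLeaf e e1 e2) v (t + t1 + 1)"
| eval_IfLeaf_False: "\<lbrakk>eval prog env e (Node l r) t; eval prog env e2 v t2\<rbrakk>
    \<Longrightarrow> eval prog env (IfLeaf e e1 e2) v (t + t2 + 1)"
| eval_Call: "\<lbrakk>f < length prog; evals prog env es vs t; eval prog vs (prog ! f) v t'\<rbrakk>
    \<Longrightarrow> eval prog env (Call f es) v (t + t' + 1)"
| evals_Nil: "evals prog env [] [] 0"
| evals_Cons: "\<lbrakk>eval prog env e v t; evals prog env es vs t'\<rbrakk>
    \<Longrightarrow> evals prog env (e # es) (v # vs) (t + t')"

inductive_cases eval_elims:
  "eval prog env (Arg i) v t"
  "eval prog env LeafE v t"
  "eval prog env (NodeE e1 e2) v t"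
  "eval prog env (LeftE e) v t"
  "eval prog env (RightE e) v t"
  "eval prog env (IfLeaf e e1 e2) v t"
  "eval prog env (Call f es) v t"
  "evals prog env [] vs t"
  "evals prog env (e # es) vs t"

lemma eval_deterministic:
  "eval prog env e v t \<Longrightarrow> eval prog env e v' t' \<Longrightarrow> v' = v \<and> t' = t"
  "evals prog env es vs t \<Longrightarrow> evals prog env es vs' t' \<Longrightarrow> vs' = vs \<and> t' = t"
proof (induction arbitrary: v' t' and vs' t' rule: eval_evals.inducts)
  case (eval_Arg i env)
  from eval_Arg.prems show ?case by (rule eval_elims) simp
next
  case (eval_LeafE env)
  from eval_LeafE.prems show ?case by (rule eval_elims) simp
next
  case (eval_NodeE env e1 v1 t1 e2 v2 t2)
  from eval_NodeE.prems show ?case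
    by (rule eval_elims) (auto dest!: eval_NodeE.IH(2) eval_NodeE.IH(4))
next
  case (eval_LeftE env e v t)
  from eval_LeftE.prems show ?case
    by (rule eval_elims) (auto dest!: eval_LeftE.IH(2))
next
  case (eval_RightE env e v t)
  from eval_RightE.prems show ?case
    by (rule eval_elims) (auto dest!: eval_RightE.IH(2))
next
  case (eval_IfLeaf_True env e t e1 v t1 e2)
  from eval_IfLeaf_True.prems show ?case
    by (rule eval_elims) (auto dest!: eval_IfLeaf_True.IH(2) eval_IfLeaf_True.IH(4))
next
  case (eval_IfLeaf_False env e l r t e2 v t2 e1)
  from eval_IfLeaf_False.prems show ?case
    by (rule eval_elims) (auto dest!: eval_IfLeaf_False.IH(2) eval_IfLeaf_False.IH(4))
next
  case (eval_Call f env es vs t v u)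
  from eval_Call.prems show ?case
    by (rule eval_elims) (auto dest!: eval_Call.IH(3) eval_Call.IH(5))
next
  case (evals_Nil env)
  from evals_Nil.prems show ?case by (rule eval_elims) simp
next
  case (evals_Cons env e v t es vs t')
  from evals_Cons.prems show ?case
    by (rule eval_elims) (auto dest!: evals_Cons.IH(2) evals_Cons.IH(4))
qed

text \<open>The main function is the first one; it is called with the input as its only argument.\<close>

definition run :: "program \<Rightarrow> tree \<Rightarrow> tree \<Rightarrow> nat \<Rightarrow> bool" where
  "run prog x v t \<longleftrightarrow> eval prog [x] (Call 0 [Arg 0]) v t"

definition enc_bool :: "bool \<Rightarrow> tree" where
  "enc_bool b = (if b then Node Leaf Leaf else Leaf)"

text \<open>
  \<open>enc x w\<close> says that \<open>w\<close> is an encoding of the instance \<open>x\<close>. The time bound is measured in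
  \<open>sz x\<close>; it is the strong form \<open>2\<close> to the power \<open>O(sz x)\<close> of exponential time.
\<close>

definition decidable_in_exp_time ::
  "('i \<Rightarrow> bool) \<Rightarrow> ('i \<Rightarrow> tree \<Rightarrow> bool) \<Rightarrow> ('i \<Rightarrow> nat) \<Rightarrow> ('i \<Rightarrow> bool) \<Rightarrow> bool" where
  "decidable_in_exp_time instance_of enc sz problem \<longleftrightarrow>
     (\<exists>prog c. \<forall>x w. instance_of x \<and> enc x w \<longrightarrow>
        (\<exists>t. run prog w (enc_bool (problem x)) t \<and> t \<le> 2 ^ (c * (sz x + 1))))"


section \<open>Encoding of samples\<close>

primrec enc_nat :: "nat \<Rightarrow> tree" where
  "enc_nat 0 = Leaf"
| "enc_nat (Suc n) = Node Leaf (enc_nat n)"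

primrec enc_list :: "tree list \<Rightarrow> tree" where
  "enc_list [] = Leaf"
| "enc_list (x # xs) = Node x (enc_list xs)"

text \<open>
  Names of states and propositions are encoded by their rank, since \<open>cgs_size\<close> does not depend
  on the names. All encodings below have size polynomial in \<open>sample_size\<close>.
\<close>

definition rank :: "nat set \<Rightarrow> nat \<Rightarrow> nat" where
  "rank X x = card {y \<in> X. y < x}"

definition enc_set :: "nat set \<Rightarrow> nat set \<Rightarrow> tree" where
  "enc_set X Y = enc_list (map (\<lambda>y. enc_nat (rank X y)) (sorted_list_of_set Y))"

definition moves_list :: "cgs \<Rightarrow> nat \<Rightarrow> nat list list" where
  "moves_list C q =
     product_lists (map (\<lambda>a. [1..<Suc (nact C (q, a))]) [1..<Suc (nagents C)])"

lemma set_moves_list: "set (moves_list C q) = moves C q"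
  unfolding moves_list_def moves_def product_lists_set agents_def act_def
proof (intro Collect_cong iffI)
  fix \<alpha>
  assume l: "list_all2 (\<lambda>x ys. x \<in> set ys) \<alpha>
    (map (\<lambda>a. [1..<Suc (nact C (q, a))]) [1..<Suc (nagents C)])"
  then have len: "length \<alpha> = nagents C"
    by (auto dest: list_all2_lengthD)
  have "\<alpha> ! (a - 1) \<in> {1..nact C (q, a)}" if "a \<in> {1..nagents C}" for a
    using list_all2_nthD[OF l, of "a - 1"] that len
    by (cases a) (auto simp del: upt_Suc)
  with len show "length \<alpha> = nagents C \<and>
      (\<forall>a\<in>{1..nagents C}. \<alpha> ! (a - 1) \<in> {1..nact C (q, a)})"
    by blast
next
  fix \<alpha>
  assume r: "length \<alpha> = nagents C \<and>
      (\<forall>a\<in>{1..nagents C}. \<alpha> ! (a - 1) \<in> {1..nact C (q, a)})"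
  have "\<alpha> ! i \<in> {1..nact C (q, Suc i)}" if "i < nagents C" for i
    using r that by (auto dest: bspec[of _ _ "Suc i"])
  with r show "list_all2 (\<lambda>x ys. x \<in> set ys) \<alpha>
    (map (\<lambda>a. [1..<Suc (nact C (q, a))]) [1..<Suc (nagents C)])"
    by (auto simp: list_all2_conv_all_nth less_Suc_eq_le simp del: upt_Suc)
qed

definition enc_state :: "nat set \<Rightarrow> cgs \<Rightarrow> nat \<Rightarrow> tree" where
  "enc_state AP C q = enc_list
     [enc_bool (q \<in> inits C),
      enc_set AP (label C q),
      enc_list (map (\<lambda>a. enc_nat (nact C (q, a))) [1..<Suc (nagents C)]),
      enc_list (map (\<lambda>\<alpha>. Node (enc_list (map enc_nat \<alpha>))
                              (enc_nat (rank (states C) (step C (q, \<alpha>)))))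
                  (moves_list C q))]"

definition enc_cgs :: "nat set \<Rightarrow> cgs \<Rightarrow> tree" where
  "enc_cgs AP C = enc_list
     [enc_nat (nagents C),
      enc_set AP (props C),
      enc_list (map (enc_state AP C) (sorted_list_of_set (states C)))]"

text \<open>The structures of a sample may be listed in any order.\<close>

definition encodes_sample :: "sample \<Rightarrow> tree \<Rightarrow> bool" where
  "encodes_sample S w \<longleftrightarrow>
     (\<exists>Ps Ns. S = (set Ps, set Ns) \<and> distinct Ps \<and> distinct Ns \<and>
        w = Node (enc_list (map (enc_cgs (sample_props S)) Ps))
                 (enc_list (map (enc_cgs (sample_props S)) Ns)))"

end

theory Submission
  imports Defs
begin

text \<open>
  The set of states (of all structures) satisfying an operator applied to formulas depends only on
  the sets of states satisfying its arguments. Hence, in a maximal subformula-closed set of formulas with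
  pairwise distinct satisfaction sets, every formula is equivalent to a member; such a set has at
  most \<open>2\<close> to the power \<open>|Q|\<close> elements, which bounds the size of a consistent formula.

  For the decision procedure, the satisfaction sets of all formulas are computed by saturating the
  sets of the propositions under the operators. In the tree language a program whose calls are
  nested to depth \<open>d\<close> runs in time \<open>2\<close> to the power \<open>O(d)\<close>, so it suffices to bound the nesting
  depth linearly: satisfaction sets are bit vectors, sets of vectors are binary tries, all vectors
  and coalitions are enumerated by recursion on their length, and the exponentially many saturation
  rounds are made by a doubling recursion.
\<close>

section \<open>Running time and call depth\<close>

text \<open>Nested loops add their depths: an enumeration of bit vectors of length \<open>m\<close>
  contributes \<open>m\<close> levels although it visits \<open>2 ^ m\<close> vectors, so rounds,
  pairs of vectors, coalitions and fixpoint iterations together stay within a constant multiple of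
  one bound \<open>B\<close>. A list of all satisfaction sets could not replace the trie, since
  walking along it would need exponential depth. Unary numbers are harmless: ranks, actions and the
  lengths of labels and move lists are bounded by sizes that the sample pays for. The bound is
  \<open>B = 2 * (sample_size S + 1)\<close>: twice because a structure may be both positive and
  negative and then owns two blocks of each vector, plus one because a structure without states,
  agents and propositions has size 0 but is still traversed. Computing the operators on vectors
  rests on replacing history-dependent strategies by iterations of the one-step operator
  \<open>pre\<close>, which stabilise within \<open>card (states C)\<close> steps; iterating as
  often as there are states in total serves all structures at once.\<close>

primrec ev :: "(nat \<Rightarrow> tree list \<Rightarrow> tree option) \<Rightarrow> tree list \<Rightarrow> expr \<Rightarrow> tree option" where
  "ev F env (Arg i) = (if i < length env then Some (env ! i) else None)"
| "ev F env LeafE = Some Leaf"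
| "ev F env (NodeE e1 e2) = Option.bind (ev F env e1) (\<lambda>x. map_option (Node x) (ev F env e2))"
| "ev F env (LeftE e) = map_option left (ev F env e)"
| "ev F env (RightE e) = map_option right (ev F env e)"
| "ev F env (IfLeaf e e1 e2) =
     Option.bind (ev F env e) (\<lambda>x. if x = Leaf then ev F env e1 else ev F env e2)"
| "ev F env (Call f es) = Option.bind (those (map (ev F env) es)) (F f)"

text \<open>Here \<open>d\<close> is fuel for the nesting of calls, not for the number of steps, and
  \<open>None\<close> also stands for too little fuel. The correctness proofs below track depths
  only and never mention running times.\<close>

primrec call :: "program \<Rightarrow> nat \<Rightarrow> nat \<Rightarrow> tree list \<Rightarrow> tree option" where
  "call prog 0 = (\<lambda>f vs. None)"
| "call prog (Suc d) = (\<lambda>f vs. if f < length prog then ev (call prog d) vs (prog ! f) else None)"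

primrec nodes :: "expr \<Rightarrow> nat" where
  "nodes (Arg i) = 1"
| "nodes LeafE = 1"
| "nodes (NodeE e1 e2) = Suc (nodes e1 + nodes e2)"
| "nodes (LeftE e) = Suc (nodes e)"
| "nodes (RightE e) = Suc (nodes e)"
| "nodes (IfLeaf e e1 e2) = Suc (nodes e + nodes e1 + nodes e2)"
| "nodes (Call f es) = Suc (sum_list (map nodes es))"

text \<open>Every node is evaluated at most once and pays 1 for itself; a call node also pays for
  the body it enters. The strict bound \<open>t < K\<close> absorbs the unit of the call node
  itself, so \<open>K\<close> per node is enough.\<close>

lemma ev_imp_eval:
  assumes F: "\<And>f vs v. F f vs = Some v \<Longrightarrow>
    f < length prog \<and> (\<exists>t<K. eval prog vs (prog ! f) v t)"
    and K: "0 < K"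
  shows "ev F env e = Some v \<Longrightarrow> \<exists>t\<le>nodes e * K. eval prog env e v t"
proof (induction e arbitrary: v)
  case (Arg i)
  then show ?case using K by (auto split: if_splits intro!: exI[of _ 1] eval_Arg)
next
  case LeafE
  then show ?case using K by (auto intro!: exI[of _ 1] eval_LeafE)
next
  case (NodeE e1 e2)
  then obtain x y where "ev F env e1 = Some x" "ev F env e2 = Some y" and v: "v = Node x y"
    by (auto simp: bind_eq_Some_conv)
  with NodeE.IH obtain t1 t2 where "t1 \<le> nodes e1 * K" "eval prog env e1 x t1"
    "t2 \<le> nodes e2 * K" "eval prog env e2 y t2" by blast
  then show ?case unfolding v using K
    using eval_NodeE[of prog env e1 x t1 e2 y t2]
    by (intro exI[of _ "t1 + t2 + 1"]) (auto simp: add_mult_distrib)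
next
  case (LeftE e)
  then obtain x where "ev F env e = Some x" and v: "v = left x" by auto
  with LeftE.IH obtain t where "t \<le> nodes e * K" "eval prog env e x t" by blast
  then show ?case unfolding v using K eval_LeftE[of prog env e x t]
    by (intro exI[of _ "t + 1"]) auto
next
  case (RightE e)
  then obtain x where "ev F env e = Some x" and v: "v = right x" by auto
  with RightE.IH obtain t where "t \<le> nodes e * K" "eval prog env e x t" by blast
  then show ?case unfolding v using K eval_RightE[of prog env e x t]
    by (intro exI[of _ "t + 1"]) auto
next
  case (IfLeaf e e1 e2)
  then obtain x where x: "ev F env e = Some x"
    and xv: "(if x = Leaf then ev F env e1 else ev F env e2) = Some v"
    by (auto simp: bind_eq_Some_conv)
  from IfLeaf.IH(1)[OF x] obtain t where t: "t \<le> nodes e * K" "eval prog env e x t" by blast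
  show ?case
  proof (cases x)
    case Leaf
    with xv IfLeaf.IH(2) obtain t1 where "t1 \<le> nodes e1 * K" "eval prog env e1 v t1" by auto
    with t Leaf K show ?thesis
      using eval_IfLeaf_True[of prog env e t e1 v t1 e2]
      by (intro exI[of _ "t + t1 + 1"]) (auto simp: add_mult_distrib)
  next
    case (Node l r)
    with xv IfLeaf.IH(3) obtain t1 where "t1 \<le> nodes e2 * K" "eval prog env e2 v t1" by auto
    with t Node K show ?thesis
      using eval_IfLeaf_False[of prog env e l r t e2 v t1 e1]
      by (intro exI[of _ "t + t1 + 1"]) (auto simp: add_mult_distrib)
  qed
next
  case (Call f es)
  then obtain vs where vs: "those (map (ev F env) es) = Some vs" and v: "F f vs = Some v"
    by (auto simp: bind_eq_Some_conv)
  have "\<exists>t\<le>sum_list (map nodes es) * K. evals prog env es vs t"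
    using vs Call.IH
  proof (induction es arbitrary: vs)
    case Nil
    then show ?case by (auto intro: evals_Nil)
  next
    case (Cons e es)
    then obtain x xs where x: "ev F env e = Some x" and xs: "those (map (ev F env) es) = Some xs"
      and vs: "vs = x # xs" by (auto split: option.splits)
    from Cons.prems(2)[of e x] x obtain t where t: "t \<le> nodes e * K" "eval prog env e x t"
      by auto
    from Cons.IH[OF xs] Cons.prems(2) obtain t' where
      "t' \<le> sum_list (map nodes es) * K" "evals prog env es xs t'" by auto
    with t show ?case unfolding vs
      by (intro exI[of _ "t + t'"]) (auto intro: evals_Cons simp: add_mult_distrib)
  qed
  then obtain t where t: "t \<le> sum_list (map nodes es) * K" "evals prog env es vs t" by blast
  from F[OF v] obtain t' where "f < length prog" "t' < K" "eval prog vs (prog ! f) v t'" by blast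
  with t show ?case
    using eval_Call[of f prog env es vs t v t']
    by (intro exI[of _ "t + t' + 1"]) (auto simp: add_mult_distrib)
qed

text \<open>One more level of calls multiplies the time by at most the size of a body. The base
  \<open>Suc M\<close> instead of \<open>M\<close> keeps the bound strict, as
  \<open>ev_imp_eval\<close> requires in the next step.\<close>

lemma call_imp_eval:
  assumes M: "\<And>e. e \<in> set prog \<Longrightarrow> nodes e \<le> M"
  shows "call prog d f vs = Some v \<Longrightarrow>
    f < length prog \<and> (\<exists>t < Suc M ^ d. eval prog vs (prog ! f) v t)"
proof (induction d arbitrary: f vs v)
  case (Suc d)
  then have f: "f < length prog" and e: "ev (call prog d) vs (prog ! f) = Some v"
    by (auto split: if_splits)
  from ev_imp_eval[where F = "call prog d", OF Suc.IH _ e] obtain t where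
    t: "t \<le> nodes (prog ! f) * Suc M ^ d" "eval prog vs (prog ! f) v t" by auto
  have "nodes (prog ! f) * Suc M ^ d \<le> M * Suc M ^ d"
    using M[of "prog ! f"] f by (intro mult_right_mono) auto
  also have "\<dots> < Suc M ^ Suc d" by simp
  finally show ?case using t f by (auto intro: le_less_trans)
qed simp

text \<open>The base \<open>Suc M\<close> depends on the program only, so a constant factor in the
  exponent turns it into a power of 2.\<close>

lemma decidable_in_exp_timeI:
  assumes "\<And>x w. instance_of x \<Longrightarrow> enc x w \<Longrightarrow>
    call prog (c * (sz x + 1)) 0 [w] = Some (enc_bool (problem x))"
  shows "decidable_in_exp_time instance_of enc sz problem"
proof -
  define M where "M = (\<Sum>e\<leftarrow>prog. nodes e)"
  have M: "nodes e \<le> M" if "e \<in> set prog" for e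
    unfolding M_def using that by (intro member_le_sum_list) auto
  have "\<exists>t. run prog w (enc_bool (problem x)) t \<and> t \<le> 2 ^ ((Suc M * c + 2) * (sz x + 1))"
    if "instance_of x" "enc x w" for x w
  proof -
    let ?s = "sz x + 1"
    from call_imp_eval[OF M assms[OF that]] obtain t where "0 < length prog"
      and t: "t < Suc M ^ (c * ?s)" and e: "eval prog [w] (prog ! 0) (enc_bool (problem x)) t"
      by blast
    \<comment> \<open>The two extra units pay for the outer \<open>Call 0\<close> and its argument
      \<open>Arg 0\<close>; the summand 2 in the exponent absorbs them.\<close>
    then have r: "run prog w (enc_bool (problem x)) (1 + t + 1)"
      unfolding run_def using evals_Cons[OF eval_Arg[of 0 "[w]" prog] evals_Nil] e
      by (intro eval_Call) auto
    have "Suc M ^ (c * ?s) \<le> (2 ^ Suc M) ^ (c * ?s)"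
      by (intro power_mono less_imp_le[OF less_exp]) simp
    then have a: "t \<le> 2 ^ (Suc M * c * ?s)" using t
      unfolding mult.assoc power_mult[symmetric] by linarith
    have "2 + (2::nat) ^ (Suc M * c * ?s) \<le> 2 ^ (Suc M * c * ?s) * 2 ^ 2"
    proof -
      have "(1::nat) \<le> 2 ^ (Suc M * c * ?s)" by simp
      then show ?thesis unfolding power2_eq_square by linarith
    qed
    also have "\<dots> \<le> 2 ^ ((Suc M * c + 2) * ?s)"
      unfolding power_add[symmetric] by (intro power_increasing) (simp_all add: algebra_simps)
    finally show ?thesis using r a by (intro exI[of _ "1 + t + 1"]) auto
  qed
  then show ?thesis unfolding decidable_in_exp_time_def by blast
qed

section \<open>Winning regions as fixpoints\<close>

lemma chain_stabilizes:
  fixes X :: "nat \<Rightarrow> 'a set"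
  assumes U: "finite U" and sub: "\<And>i. X i \<subseteq> U" and inc: "\<And>i. X i \<subseteq> X (Suc i)"
  shows "\<exists>i\<le>card U. X (Suc i) = X i"
proof (rule ccontr)
  assume "\<not> ?thesis"
  then have less: "X i \<subset> X (Suc i)" if "i \<le> card U" for i using that inc[of i] by blast
  have "i \<le> Suc (card U) \<Longrightarrow> i \<le> card (X i)" for i
  proof (induction i)
    case (Suc i)
    then have "card (X i) < card (X (Suc i))"
      using psubset_card_mono[OF finite_subset[OF sub U] less[of i]] by simp
    then show ?case using Suc by simp
  qed simp
  from this[of "Suc (card U)"] card_mono[OF U sub[of "Suc (card U)"]] show False by simp
qed

text \<open>\<open>det\<close> makes the first repetition permanent, so every index from
  \<open>card U\<close> on is stable.\<close>

lemma iteration_stabilizes: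
  fixes X :: "nat \<Rightarrow> 'a set"
  assumes "finite U" and "\<And>i. X i \<subseteq> U" and "\<And>i. X i \<subseteq> X (Suc i)"
    and det: "\<And>i j. X i = X j \<Longrightarrow> X (Suc i) = X (Suc j)" and n: "card U \<le> n"
  shows "X (Suc n) = X n"
proof -
  from chain_stabilizes[of U X, OF assms(1-3)] obtain i where i: "i \<le> card U" "X (Suc i) = X i" by blast
  have "X (Suc (i + k)) = X (i + k)" for k
  proof (induction k)
    case (Suc k)
    from det[OF Suc.IH] show ?case by simp
  qed (simp add: i)
  from this[of "n - i"] i n show ?thesis by simp
qed

text \<open>
  A joint action of the coalition is represented by any move \<open>\<beta>\<close> extending it; the components of
  \<open>\<beta>\<close> outside \<open>A\<close> are irrelevant.
\<close>

definition pre :: "cgs \<Rightarrow> nat set \<Rightarrow> (nat \<Rightarrow> bool) \<Rightarrow> nat \<Rightarrow> bool" where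
  "pre C A Z q \<longleftrightarrow> (\<exists>\<beta>\<in>moves C q. \<forall>\<alpha>\<in>moves C q.
     (\<forall>a\<in>A. act \<alpha> a = act \<beta> a) \<longrightarrow> Z (step C (q, \<alpha>)))"

primrec globally_iter :: "cgs \<Rightarrow> nat set \<Rightarrow> (nat \<Rightarrow> bool) \<Rightarrow> nat \<Rightarrow> nat \<Rightarrow> bool" where
  "globally_iter C A Z 0 = Z"
| "globally_iter C A Z (Suc n) = (\<lambda>q. Z q \<and> pre C A (globally_iter C A Z n) q)"

primrec until_iter ::
  "cgs \<Rightarrow> nat set \<Rightarrow> (nat \<Rightarrow> bool) \<Rightarrow> (nat \<Rightarrow> bool) \<Rightarrow> nat \<Rightarrow> nat \<Rightarrow> bool" where
  "until_iter C A Y Z 0 = Z"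
| "until_iter C A Y Z (Suc n) = (\<lambda>q. Z q \<or> Y q \<and> pre C A (until_iter C A Y Z n) q)"

lemma step_in_states:
  assumes "is_cgs C" "q \<in> states C" "\<alpha> \<in> moves C q"
  shows "step C (q, \<alpha>) \<in> states C"
  using assms unfolding is_cgs_def Q_Act_def by auto

lemma outcomes_in_states:
  assumes C: "is_cgs C" and q: "q \<in> states C" and \<rho>: "\<rho> \<in> outcomes C A \<sigma> q"
  shows "\<rho> i \<in> states C"
proof (induction i)
  case 0
  then show ?case using \<rho> q by (simp add: outcomes_def)
next
  case (Suc i)
  from \<rho> obtain \<alpha> where "\<alpha> \<in> moves C (\<rho> i)" "\<rho> (Suc i) = step C (\<rho> i, \<alpha>)"
    unfolding outcomes_def by blast
  then show ?case using step_in_states[OF C Suc.IH] by simp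
qed

lemma can_enforce_cong:
  assumes "is_cgs C" "q \<in> states C" "\<And>\<rho>. (\<And>i. \<rho> i \<in> states C) \<Longrightarrow> W \<rho> = W' \<rho>"
  shows "can_enforce C A q W = can_enforce C A q W'"
  using assms(3) outcomes_in_states[OF assms(1,2)] unfolding can_enforce_def by blast

lemma pre_mono:
  assumes "is_cgs C" "q \<in> states C" "\<And>q. q \<in> states C \<Longrightarrow> Y q \<Longrightarrow> Z q" "pre C A Y q"
  shows "pre C A Z q"
  using assms(3,4) step_in_states[OF assms(1,2)] unfolding pre_def by blast

lemma pre_cong:
  assumes "is_cgs C" "q \<in> states C" "\<And>q. q \<in> states C \<Longrightarrow> Y q = Z q"
  shows "pre C A Y q = pre C A Z q"
  using pre_mono[OF assms(1,2), of Y Z] pre_mono[OF assms(1,2), of Z Y] assms(3) by blast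

lemma act_map: "a \<in> agents C \<Longrightarrow> act (map f [Suc 0..<Suc (nagents C)]) a = f a"
  unfolding act_def agents_def by (cases a) (auto simp del: upt_Suc)

lemma map_in_moves:
  assumes "\<And>a. a \<in> agents C \<Longrightarrow> f a \<in> {1..nact C (q, a)}"
  shows "map f [Suc 0..<Suc (nagents C)] \<in> moves C q"
  unfolding moves_def using assms by (simp add: act_map del: upt_Suc)

lemma nact_pos:
  assumes "is_cgs C" "q \<in> states C" "a \<in> agents C"
  shows "1 \<le> nact C (q, a)"
  using assms unfolding is_cgs_def by auto

locale coalition =
  fixes C :: cgs and A :: "nat set"
  assumes cgs: "is_cgs C" and coalition: "A \<subseteq> agents C"
begin

lemma strategy_move:
  assumes "strategy_profile C A \<sigma>" "h \<noteq> []" "set h \<subseteq> states C"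
  shows "\<exists>\<beta>\<in>moves C (last h). \<forall>a\<in>A. act \<beta> a = \<sigma> a h"
proof
  \<comment> \<open>Action 1 is available to every agent in every state, so it completes a joint
    action of the coalition to a move.\<close>
  let ?f = "\<lambda>a. if a \<in> A then \<sigma> a h else 1"
  have "last h \<in> states C" using assms(2,3) last_in_set[of h] by blast
  then show "map ?f [Suc 0..<Suc (nagents C)] \<in> moves C (last h)"
    using assms nact_pos[OF cgs] by (intro map_in_moves) (auto simp: strategy_profile_def)
  show "\<forall>a\<in>A. act (map ?f [Suc 0..<Suc (nagents C)]) a = \<sigma> a h"
    using coalition by (auto simp: act_map simp del: upt_Suc)
qed

text \<open>\<open>\<mu>\<close> fixes the replies of the opponents as well, depending on the
  history. The plays against a strategy that are needed below are all produced from such a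
  function.\<close>

lemma outcome_exists:
  assumes q: "q \<in> states C"
    and \<mu>: "\<And>h. h \<noteq> [] \<Longrightarrow> set h \<subseteq> states C \<Longrightarrow>
      \<mu> h \<in> moves C (last h) \<and> (\<forall>a\<in>A. act (\<mu> h) a = \<sigma> a h)"
  shows "\<exists>\<rho>\<in>outcomes C A \<sigma> q. \<forall>i. \<rho> (Suc i) = step C (\<rho> i, \<mu> (map \<rho> [0..<Suc i]))"
proof -
  \<comment> \<open>\<open>H n\<close> is the history of length \<open>n + 1\<close>; whole
    histories are built because \<open>\<mu>\<close> needs them.\<close>
  define H where "H = rec_nat [q] (\<lambda>_ h. h @ [step C (last h, \<mu> h)])"
  have H0: "H 0 = [q]" and HS: "H (Suc n) = H n @ [step C (last (H n), \<mu> (H n))]" for n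
    by (simp_all add: H_def)
  define \<rho> where "\<rho> n = last (H n)" for n
  have inv: "H n \<noteq> [] \<and> set (H n) \<subseteq> states C" for n
  proof (induction n)
    case (Suc n)
    then have "last (H n) \<in> states C" by auto
    then show ?case using Suc \<mu>[of "H n"] step_in_states[OF cgs] by (auto simp: HS)
  qed (simp add: H0 q)
  have eq: "map \<rho> [0..<Suc n] = H n" for n
    by (induction n) (auto simp: H0 HS \<rho>_def)
  have step: "\<rho> (Suc n) = step C (\<rho> n, \<mu> (map \<rho> [0..<Suc n]))" for n
    unfolding eq by (simp add: HS \<rho>_def)
  have "\<mu> (H n) \<in> moves C (\<rho> n) \<and> (\<forall>a\<in>A. act (\<mu> (H n)) a = \<sigma> a (map \<rho> [0..<Suc n]))" for n
    unfolding eq using \<mu>[of "H n"] inv[of n] by (simp add: \<rho>_def)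
  then have "\<rho> \<in> outcomes C A \<sigma> q"
    unfolding outcomes_def using step eq by (auto simp: H0 \<rho>_def simp del: upt_Suc)
  with step show ?thesis by blast
qed

lemma some_outcome:
  assumes "strategy_profile C A \<sigma>" "q \<in> states C"
  shows "\<exists>\<rho>. \<rho> \<in> outcomes C A \<sigma> q"
proof -
  from strategy_move[OF assms(1)] obtain \<mu> where
    "\<And>h. h \<noteq> [] \<Longrightarrow> set h \<subseteq> states C \<Longrightarrow>
      \<mu> h \<in> moves C (last h) \<and> (\<forall>a\<in>A. act (\<mu> h) a = \<sigma> a h)" by metis
  from outcome_exists[OF assms(2) this] show ?thesis by blast
qed

definition positional :: "(nat \<Rightarrow> nat list) \<Rightarrow> nat \<Rightarrow> nat list \<Rightarrow> nat" where
  "positional \<beta> a h = act (\<beta> (last h)) a"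

lemma strategy_profile_positional:
  assumes "\<And>q. q \<in> states C \<Longrightarrow> \<beta> q \<in> moves C q"
  shows "strategy_profile C A (positional \<beta>)"
  unfolding strategy_profile_def
proof (intro ballI allI impI)
  fix a and h :: "nat list"
  assume a: "a \<in> A" and "h \<noteq> [] \<and> set h \<subseteq> states C"
  then have "last h \<in> states C" using last_in_set[of h] by blast
  from assms[OF this] show "positional \<beta> a h \<in> {1..nact C (last h, a)}"
    using a coalition unfolding positional_def moves_def by blast
qed

lemma outcome_positional:
  assumes "\<rho> \<in> outcomes C A (positional \<beta>) q"
  shows "\<exists>\<alpha>\<in>moves C (\<rho> i). (\<forall>a\<in>A. act \<alpha> a = act (\<beta> (\<rho> i)) a) \<and> \<rho> (Suc i) = step C (\<rho> i, \<alpha>)"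
  using assms unfolding outcomes_def positional_def by simp

lemma moves_nonempty: "q \<in> states C \<Longrightarrow> moves C q \<noteq> {}"
  using map_in_moves[of C "\<lambda>_. 1" q] nact_pos[OF cgs] by fastforce

text \<open>The target may depend on the current state \<open>q\<close>: for until it is a level
  below that of \<open>q\<close>, for the other operators it is constant. Where \<open>pre\<close>
  fails an arbitrary move is chosen, so that the strategy is defined in all states.\<close>

lemma positional_choice:
  fixes Z :: "nat \<Rightarrow> nat \<Rightarrow> bool"
  obtains \<beta> where "\<And>q. q \<in> states C \<Longrightarrow> \<beta> q \<in> moves C q"
    and "\<And>q \<alpha>. pre C A (Z q) q \<Longrightarrow> \<alpha> \<in> moves C q \<Longrightarrow> \<forall>a\<in>A. act \<alpha> a = act (\<beta> q) a \<Longrightarrow>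
      Z q (step C (q, \<alpha>))"
proof -
  have "\<exists>\<beta>. (q \<in> states C \<longrightarrow> \<beta> \<in> moves C q) \<and> (pre C A (Z q) q \<longrightarrow>
     (\<forall>\<alpha>\<in>moves C q. (\<forall>a\<in>A. act \<alpha> a = act \<beta> a) \<longrightarrow> Z q (step C (q, \<alpha>))))" for q
    using moves_nonempty[of q] unfolding pre_def by blast
  then obtain \<beta> where "\<forall>q. (q \<in> states C \<longrightarrow> \<beta> q \<in> moves C q) \<and> (pre C A (Z q) q \<longrightarrow>
     (\<forall>\<alpha>\<in>moves C q. (\<forall>a\<in>A. act \<alpha> a = act (\<beta> q) a) \<longrightarrow> Z q (step C (q, \<alpha>))))"
    by metis
  then show ?thesis by (intro that[of \<beta>]) auto
qed

lemma can_enforce_next: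
  assumes q: "q \<in> states C"
  shows "can_enforce C A q (\<lambda>\<rho>. Z (\<rho> 1)) \<longleftrightarrow> pre C A Z q"
proof
  assume "can_enforce C A q (\<lambda>\<rho>. Z (\<rho> 1))"
  then obtain \<sigma> where \<sigma>: "strategy_profile C A \<sigma>"
    and win: "\<And>\<rho>. \<rho> \<in> outcomes C A \<sigma> q \<Longrightarrow> Z (\<rho> 1)" unfolding can_enforce_def by blast
  from strategy_move[OF \<sigma>] obtain \<mu> where \<mu>:
    "\<And>h. h \<noteq> [] \<Longrightarrow> set h \<subseteq> states C \<Longrightarrow>
      \<mu> h \<in> moves C (last h) \<and> (\<forall>a\<in>A. act (\<mu> h) a = \<sigma> a h)" by metis
  show "pre C A Z q"
    unfolding pre_def
  proof (intro bexI[of _ "\<mu> [q]"] ballI impI)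
    show "\<mu> [q] \<in> moves C q" using \<mu>[of "[q]"] q by simp
    fix \<alpha> assume \<alpha>: "\<alpha> \<in> moves C q" "\<forall>a\<in>A. act \<alpha> a = act (\<mu> [q]) a"
    \<comment> \<open>Only the reply at the history \<open>[q]\<close> is changed; the resulting
      play takes the given successor as its first step.\<close>
    have "(\<mu>([q] := \<alpha>)) h \<in> moves C (last h) \<and> (\<forall>a\<in>A. act ((\<mu>([q] := \<alpha>)) h) a = \<sigma> a h)"
      if "h \<noteq> []" "set h \<subseteq> states C" for h
      using \<mu>[OF that] \<alpha> by auto
    from outcome_exists[OF q this] obtain \<rho> where \<rho>: "\<rho> \<in> outcomes C A \<sigma> q"
      and step: "\<And>i. \<rho> (Suc i) = step C (\<rho> i, (\<mu>([q] := \<alpha>)) (map \<rho> [0..<Suc i]))" by blast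
    from \<rho> have "\<rho> 0 = q" unfolding outcomes_def by simp
    with step[of 0] have "\<rho> 1 = step C (q, \<alpha>)" by simp
    with win[OF \<rho>] show "Z (step C (q, \<alpha>))" by simp
  qed
next
  assume pre: "pre C A Z q"
  obtain \<beta> where \<beta>: "\<And>q. q \<in> states C \<Longrightarrow> \<beta> q \<in> moves C q"
    and win: "\<And>q \<alpha>. pre C A Z q \<Longrightarrow> \<alpha> \<in> moves C q \<Longrightarrow> \<forall>a\<in>A. act \<alpha> a = act (\<beta> q) a \<Longrightarrow>
      Z (step C (q, \<alpha>))" using positional_choice[of "\<lambda>_. Z"] by blast
  have "Z (\<rho> 1)" if \<rho>: "\<rho> \<in> outcomes C A (positional \<beta>) q" for \<rho>
  proof -
    have "\<rho> 0 = q" using \<rho> unfolding outcomes_def by simp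
    with outcome_positional[OF \<rho>, of 0] win[OF pre] show ?thesis by auto
  qed
  then show "can_enforce C A q (\<lambda>\<rho>. Z (\<rho> 1))"
    unfolding can_enforce_def using strategy_profile_positional[OF \<beta>] by blast
qed

text \<open>The winning region is a post-fixpoint: after the first step the coalition continues with
  the residual strategy that puts \<open>q\<close> in front of each history, and a play from the
  successor becomes one from \<open>q\<close> by prepending \<open>q\<close>.\<close>

lemma globally_unfold:
  assumes q: "q \<in> states C" and W: "can_enforce C A q (\<lambda>\<rho>. \<forall>i. Z (\<rho> i))"
  shows "Z q" and "pre C A (\<lambda>q. can_enforce C A q (\<lambda>\<rho>. \<forall>i. Z (\<rho> i))) q"
proof -
  from W obtain \<sigma> where \<sigma>: "strategy_profile C A \<sigma>"
    and win: "\<And>\<rho> i. \<rho> \<in> outcomes C A \<sigma> q \<Longrightarrow> Z (\<rho> i)" unfolding can_enforce_def by blast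
  \<comment> \<open>Without a consistent play the winning condition would hold vacuously and say
    nothing about \<open>q\<close>.\<close>
  from some_outcome[OF \<sigma> q] obtain \<rho> where "\<rho> \<in> outcomes C A \<sigma> q" by blast
  with win[OF this, of 0] show "Z q" by (simp add: outcomes_def)
  from strategy_move[OF \<sigma>, of "[q]"] q obtain \<beta> where \<beta>: "\<beta> \<in> moves C q"
    "\<forall>a\<in>A. act \<beta> a = \<sigma> a [q]" by auto
  show "pre C A (\<lambda>q. can_enforce C A q (\<lambda>\<rho>. \<forall>i. Z (\<rho> i))) q"
    unfolding pre_def
  proof (intro bexI[OF _ \<beta>(1)] ballI impI)
    fix \<alpha> assume \<alpha>: "\<alpha> \<in> moves C q" "\<forall>a\<in>A. act \<alpha> a = act \<beta> a"
    let ?\<tau> = "\<lambda>a h. \<sigma> a (q # h)"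
    have "strategy_profile C A ?\<tau>"
      unfolding strategy_profile_def
    proof (intro ballI allI impI)
      fix a and h :: "nat list"
      assume "a \<in> A" "h \<noteq> [] \<and> set h \<subseteq> states C"
      then show "\<sigma> a (q # h) \<in> {1..nact C (last h, a)}"
        using \<sigma>[unfolded strategy_profile_def, rule_format, of a "q # h"] q by simp
    qed
    moreover have "Z (\<rho> i)" if \<rho>: "\<rho> \<in> outcomes C A ?\<tau> (step C (q, \<alpha>))" for \<rho> i
    proof -
      have hist: "map (case_nat q \<rho>) [0..<Suc i] = q # map \<rho> [0..<i]" for i
        by (simp add: upt_conv_Cons map_Suc_upt[symmetric] del: upt_Suc)
      have "case_nat q \<rho> \<in> outcomes C A \<sigma> q"
        unfolding outcomes_def
      proof (intro CollectI conjI allI)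
        fix i
        show "\<exists>\<alpha>\<in>moves C (case_nat q \<rho> i).
            (\<forall>a\<in>A. act \<alpha> a = \<sigma> a (map (case_nat q \<rho>) [0..<Suc i])) \<and>
            case_nat q \<rho> (Suc i) = step C (case_nat q \<rho> i, \<alpha>)"
        proof (cases i)
          case 0
          then show ?thesis using \<alpha> \<beta> \<rho>
            by (intro bexI[of _ \<alpha>]) (auto simp: outcomes_def)
        next
          case (Suc j)
          then show ?thesis using \<rho> unfolding outcomes_def hist by simp
        qed
      qed simp
      from win[OF this, of "Suc i"] show ?thesis by simp
    qed
    ultimately show "can_enforce C A (step C (q, \<alpha>)) (\<lambda>\<rho>. \<forall>i. Z (\<rho> i))"
      unfolding can_enforce_def by blast
  qed
qed

lemma globally_iter_stable:
  assumes "card (states C) \<le> n" "q \<in> states C"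
  shows "globally_iter C A Z (Suc n) q = globally_iter C A Z n q"
proof -
  \<comment> \<open>The iterates decrease, so the result on increasing chains is applied to their
    complements.\<close>
  let ?X = "\<lambda>n. {q \<in> states C. \<not> globally_iter C A Z n q}"
  have *: "q \<in> states C \<Longrightarrow> globally_iter C A Z (Suc i) q \<Longrightarrow> globally_iter C A Z i q" for i q
  proof (induction i arbitrary: q)
    case (Suc i)
    from Suc.prems(2) have "Z q" "pre C A (globally_iter C A Z (Suc i)) q" by simp_all
    with pre_mono[OF cgs Suc.prems(1) _ this(2), of "globally_iter C A Z i"] Suc.IH
    show ?case by simp
  qed simp
  have "?X (Suc n) = ?X n"
  proof (rule iteration_stabilizes[where U = "states C"])
    show "?X (Suc i) = ?X (Suc j)" if "?X i = ?X j" for i j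
    proof -
      have "globally_iter C A Z i q = globally_iter C A Z j q" if "q \<in> states C" for q
        using \<open>?X i = ?X j\<close> that by blast
      from pre_cong[OF cgs _ this] show ?thesis by auto
    qed
  qed (use assms(1) cgs * in \<open>auto simp: is_cgs_def\<close>)
  with assms(2) show ?thesis by blast
qed

text \<open>Left to right, a post-fixpoint lies below every iterate. Right to left, the stable
  iterate is itself a post-fixpoint, and a positional strategy that never leaves it wins.\<close>

lemma can_enforce_globally:
  assumes n: "card (states C) \<le> n" and q: "q \<in> states C"
  shows "can_enforce C A q (\<lambda>\<rho>. \<forall>i. Z (\<rho> i)) \<longleftrightarrow> globally_iter C A Z n q"
proof
  have "q \<in> states C \<Longrightarrow> can_enforce C A q (\<lambda>\<rho>. \<forall>i. Z (\<rho> i)) \<Longrightarrow> globally_iter C A Z m q" for m q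
  proof (induction m arbitrary: q)
    case 0
    then show ?case using globally_unfold(1) by simp
  next
    case (Suc m)
    from globally_unfold[OF Suc.prems] pre_mono[OF cgs Suc.prems(1) Suc.IH] show ?case by simp
  qed
  then show "can_enforce C A q (\<lambda>\<rho>. \<forall>i. Z (\<rho> i)) \<Longrightarrow> globally_iter C A Z n q" using q by blast
next
  let ?G = "globally_iter C A Z n"
  assume G: "?G q"
  obtain \<beta> where \<beta>: "\<And>q. q \<in> states C \<Longrightarrow> \<beta> q \<in> moves C q"
    and win: "\<And>q \<alpha>. pre C A ?G q \<Longrightarrow> \<alpha> \<in> moves C q \<Longrightarrow> \<forall>a\<in>A. act \<alpha> a = act (\<beta> q) a \<Longrightarrow>
      ?G (step C (q, \<alpha>))" using positional_choice[of "\<lambda>_. ?G"] by blast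
  have "Z (\<rho> i)" if \<rho>: "\<rho> \<in> outcomes C A (positional \<beta>) q" for \<rho> i
  proof -
    have in_G: "Z (\<rho> i) \<and> pre C A ?G (\<rho> i)" if "?G (\<rho> i)" for i
      using that globally_iter_stable[OF n outcomes_in_states[OF cgs q \<rho>]] by simp
    have "?G (\<rho> i)" for i
    proof (induction i)
      case 0
      then show ?case using G \<rho> by (simp add: outcomes_def)
    next
      case (Suc i)
      from outcome_positional[OF \<rho>, of i] win in_G[OF Suc] show ?case by auto
    qed
    with in_G show ?thesis by blast
  qed
  then show "can_enforce C A q (\<lambda>\<rho>. \<forall>i. Z (\<rho> i))"
    unfolding can_enforce_def using strategy_profile_positional[OF \<beta>] by blast
qed

lemma until_iter_mono:
  assumes "q \<in> states C" "until_iter C A Y Z i q"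
  shows "until_iter C A Y Z (Suc i) q"
  using assms
proof (induction i arbitrary: q)
  case (Suc i)
  then show ?case using pre_mono[OF cgs Suc.prems(1) Suc.IH] by auto
qed simp

lemma until_iter_stable:
  assumes "card (states C) \<le> n" "q \<in> states C"
  shows "until_iter C A Y Z (Suc n) q = until_iter C A Y Z n q"
proof -
  let ?X = "\<lambda>n. {q \<in> states C. until_iter C A Y Z n q}"
  have "?X (Suc n) = ?X n"
  proof (rule iteration_stabilizes[where U = "states C"])
    show "?X (Suc i) = ?X (Suc j)" if "?X i = ?X j" for i j
    proof -
      have "until_iter C A Y Z i q = until_iter C A Y Z j q" if "q \<in> states C" for q
        using \<open>?X i = ?X j\<close> that by blast
      from pre_cong[OF cgs _ this] show ?thesis by auto
    qed
    show "?X i \<subseteq> ?X (Suc i)" for i using until_iter_mono by blast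
  qed (use assms(1) cgs in \<open>auto simp: is_cgs_def\<close>)
  with assms(2) show ?thesis by blast
qed

text \<open>Right to left, the iteration index is a rank that decreases along every consistent play
  until \<open>Z\<close> is reached. Left to right, the stable iterate is a fixpoint, so from
  outside it the opponents can answer any strategy so as to stay outside as long as \<open>Y\<close>
  holds, and \<open>Z\<close> is not reached in time.\<close>

lemma can_enforce_until:
  assumes n: "card (states C) \<le> n" and q: "q \<in> states C"
  shows "can_enforce C A q (\<lambda>\<rho>. \<exists>i. Z (\<rho> i) \<and> (\<forall>j<i. Y (\<rho> j))) \<longleftrightarrow> until_iter C A Y Z n q"
    (is "?W \<longleftrightarrow> _")
proof
  let ?L = "until_iter C A Y Z"
  assume L: "?L n q"
  \<comment> \<open>The \<open>Suc\<close> makes the target the level just below the first positive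
    level that contains \<open>q\<close>; states of level 0 satisfy \<open>Z\<close>
    already.\<close>
  let ?P = "\<lambda>q. ?L (LEAST m. ?L (Suc m) q)"
  obtain \<beta> where \<beta>: "\<And>q. q \<in> states C \<Longrightarrow> \<beta> q \<in> moves C q"
    and win: "\<And>q \<alpha>. pre C A (?P q) q \<Longrightarrow> \<alpha> \<in> moves C q \<Longrightarrow> \<forall>a\<in>A. act \<alpha> a = act (\<beta> q) a \<Longrightarrow>
      ?P q (step C (q, \<alpha>))" using positional_choice[of ?P] by blast
  have "\<exists>i. Z (\<rho> i) \<and> (\<forall>j<i. Y (\<rho> j))" if \<rho>: "\<rho> \<in> outcomes C A (positional \<beta>) q" for \<rho>
  proof -
    have "?L m (\<rho> k) \<Longrightarrow> \<exists>i. Z (\<rho> (k + i)) \<and> (\<forall>j<i. Y (\<rho> (k + j)))" for m k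
    proof (induction m arbitrary: k rule: less_induct)
      case (less m)
      show ?case
      proof (cases "Z (\<rho> k)")
        case True
        then show ?thesis by (intro exI[of _ 0]) simp
      next
        case False
        define l where "l = (LEAST m. ?L (Suc m) (\<rho> k))"
        from False less.prems obtain m' where m': "m = Suc m'" by (cases m) auto
        with less.prems have L: "?L (Suc m') (\<rho> k)" by simp
        then have "?L (Suc l) (\<rho> k)" unfolding l_def by (rule LeastI)
        with False have Y: "Y (\<rho> k)" and "pre C A (?L l) (\<rho> k)" by simp_all
        with outcome_positional[OF \<rho>, of k] win[of "\<rho> k", folded l_def]
        have L': "?L l (\<rho> (Suc k))" by metis
        have "l < m" using Least_le[of "\<lambda>m. ?L (Suc m) (\<rho> k)", OF L] m' by (simp add: l_def)
        from less.IH[OF this L'] obtain i where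
          i: "Z (\<rho> (Suc k + i))" "\<forall>j<i. Y (\<rho> (Suc k + j))" by blast
        then show ?thesis using Y
          by (intro exI[of _ "Suc i"]) (auto simp: less_Suc_eq_0_disj)
      qed
    qed
    from this[of n 0] show ?thesis using L \<rho> by (simp add: outcomes_def)
  qed
  then show ?W
    unfolding can_enforce_def using strategy_profile_positional[OF \<beta>] by blast
next
  let ?L = "until_iter C A Y Z n"
  assume ?W
  then obtain \<sigma> where \<sigma>: "strategy_profile C A \<sigma>"
    and win: "\<And>\<rho>. \<rho> \<in> outcomes C A \<sigma> q \<Longrightarrow> \<exists>i. Z (\<rho> i) \<and> (\<forall>j<i. Y (\<rho> j))"
    unfolding can_enforce_def by blast
  show "?L q"
  proof (rule ccontr)
    assume notL: "\<not> ?L q"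
    \<comment> \<open>The reply is chosen per history, because the strategy to be refuted may use
      its memory.\<close>
    have "\<exists>\<mu>. \<mu> \<in> moves C (last h) \<and> (\<forall>a\<in>A. act \<mu> a = \<sigma> a h) \<and>
        (\<not> pre C A ?L (last h) \<longrightarrow> \<not> ?L (step C (last h, \<mu>)))"
      if "h \<noteq> []" "set h \<subseteq> states C" for h
    proof -
      from strategy_move[OF \<sigma> that] obtain \<beta> where
        \<beta>: "\<beta> \<in> moves C (last h)" "\<forall>a\<in>A. act \<beta> a = \<sigma> a h" by blast
      show ?thesis
      proof (cases "pre C A ?L (last h)")
        case False
        with \<beta>(1) obtain \<alpha> where "\<alpha> \<in> moves C (last h)" "\<forall>a\<in>A. act \<alpha> a = act \<beta> a"
          "\<not> ?L (step C (last h, \<alpha>))" unfolding pre_def by blast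
        with \<beta>(2) show ?thesis by auto
      qed (use \<beta> in blast)
    qed
    then obtain \<mu> where \<mu>: "\<And>h. h \<noteq> [] \<Longrightarrow> set h \<subseteq> states C \<Longrightarrow>
        \<mu> h \<in> moves C (last h) \<and> (\<forall>a\<in>A. act (\<mu> h) a = \<sigma> a h) \<and>
        (\<not> pre C A ?L (last h) \<longrightarrow> \<not> ?L (step C (last h, \<mu> h)))" by metis
    obtain \<rho> where \<rho>: "\<rho> \<in> outcomes C A \<sigma> q"
      and step: "\<And>i. \<rho> (Suc i) = step C (\<rho> i, \<mu> (map \<rho> [0..<Suc i]))"
      using outcome_exists[OF q, of \<mu> \<sigma>] \<mu> by blast
    note in_states = outcomes_in_states[OF cgs q \<rho>]
    from win[OF \<rho>] obtain i where i: "Z (\<rho> i)" "\<forall>j<i. Y (\<rho> j)" by blast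
    have unfold: "?L (\<rho> j) \<longleftrightarrow> Z (\<rho> j) \<or> Y (\<rho> j) \<and> pre C A ?L (\<rho> j)" for j
      using until_iter_stable[OF n in_states] by simp
    have "j \<le> i \<Longrightarrow> \<not> ?L (\<rho> j)" for j
    proof (induction j)
      case 0
      then show ?case using notL \<rho> by (simp add: outcomes_def)
    next
      case (Suc j)
      then have "\<not> pre C A ?L (\<rho> j)" using i(2) unfold[of j] by simp
      moreover have "set (map \<rho> [0..<Suc j]) \<subseteq> states C" using in_states by auto
      ultimately show ?case using \<mu>[of "map \<rho> [0..<Suc j]"] step[of j] by simp
    qed
    with i(1) unfold[of i] show False by blast
  qed
qed

end

lemma sat_EnfX:
  assumes "is_cgs C" "A \<subseteq> agents C" "q \<in> states C"
  shows "sat C (EnfX A \<Phi>) q = pre C A (sat C \<Phi>) q"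
  using coalition.can_enforce_next[of C A q "sat C \<Phi>"] assms by (simp add: coalition_def)

text \<open>Admitting any \<open>n\<close> from the number of states on lets one iteration count
  serve structures of different sizes.\<close>

lemma sat_EnfG:
  assumes "is_cgs C" "A \<subseteq> agents C" "q \<in> states C" "card (states C) \<le> n"
  shows "sat C (EnfG A \<Phi>) q = globally_iter C A (sat C \<Phi>) n q"
  using coalition.can_enforce_globally[of C A n q "sat C \<Phi>"] assms by (simp add: coalition_def)

lemma sat_EnfU:
  assumes "is_cgs C" "A \<subseteq> agents C" "q \<in> states C" "card (states C) \<le> n"
  shows "sat C (EnfU A \<Phi> \<Psi>) q = until_iter C A (sat C \<Phi>) (sat C \<Psi>) n q"
  using coalition.can_enforce_until[of C A n q "sat C \<Psi>" "sat C \<Phi>"] assms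
  by (simp add: coalition_def)

section \<open>Small formulas\<close>

definition extent :: "sample \<Rightarrow> atl \<Rightarrow> (cgs \<times> nat) set" where
  "extent S \<Phi> = {(C, q) \<in> sample_states S. sat C \<Phi> q}"

lemma extent_eq_iff:
  "extent S \<Phi> = extent S \<Psi> \<longleftrightarrow>
     (\<forall>C\<in>all_cgs S. \<forall>q\<in>states C. sat C \<Phi> q = sat C \<Psi> q)"
  unfolding extent_def sample_states_def by auto

lemma consistent_cong:
  assumes S: "is_sample S" and ext: "extent S \<Phi> = extent S \<Psi>"
  shows "consistent \<Phi> S = consistent \<Psi> S"
proof (cases S)
  case (Pair P N)
  have "models C \<Phi> = models C \<Psi>" if "C \<in> P \<union> N" for C
  proof -
    have "inits C \<subseteq> states C" using S that by (auto simp: Pair is_sample_def is_cgs_def)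
    then show ?thesis
      using ext that unfolding extent_eq_iff models_def by (auto simp: Pair)
  qed
  then show ?thesis by (auto simp: Pair)
qed

text \<open>Plays never leave \<open>states C\<close>, so winning conditions that agree on plays
  through these states can be exchanged.\<close>

lemma extent_cong:
  assumes "is_sample S" "extent S \<Phi> = extent S \<Phi>'"
  shows "extent S (Neg \<Phi>) = extent S (Neg \<Phi>')"
    and "extent S \<Psi> = extent S \<Psi>' \<Longrightarrow> extent S (Conj \<Phi> \<Psi>) = extent S (Conj \<Phi>' \<Psi>')"
    and "extent S (EnfX A \<Phi>) = extent S (EnfX A \<Phi>')"
    and "extent S (EnfG A \<Phi>) = extent S (EnfG A \<Phi>')"
    and "extent S \<Psi> = extent S \<Psi>' \<Longrightarrow> extent S (EnfU A \<Phi> \<Psi>) = extent S (EnfU A \<Phi>' \<Psi>')"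
proof -
  have C: "is_cgs C" if "C \<in> all_cgs S" for C using assms(1) that by (simp add: is_sample_def)
  note eq = assms(2)[unfolded extent_eq_iff]
  show "extent S (Neg \<Phi>) = extent S (Neg \<Phi>')"
    using eq by (simp add: extent_eq_iff)
  show "extent S (Conj \<Phi> \<Psi>) = extent S (Conj \<Phi>' \<Psi>')" if "extent S \<Psi> = extent S \<Psi>'"
    using eq that by (simp add: extent_eq_iff)
  show "extent S (EnfX A \<Phi>) = extent S (EnfX A \<Phi>')"
    unfolding extent_eq_iff sat.simps using eq by (intro ballI can_enforce_cong[OF C]) auto
  show "extent S (EnfG A \<Phi>) = extent S (EnfG A \<Phi>')"
    unfolding extent_eq_iff sat.simps using eq by (intro ballI can_enforce_cong[OF C]) auto
  show "extent S (EnfU A \<Phi> \<Psi>) = extent S (EnfU A \<Phi>' \<Psi>')" if "extent S \<Psi> = extent S \<Psi>'"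
    unfolding extent_eq_iff sat.simps
  proof (intro ballI can_enforce_cong[OF C])
    fix C and \<rho> :: "nat \<Rightarrow> nat"
    assume "C \<in> all_cgs S" and \<rho>: "\<And>i. \<rho> i \<in> states C"
    then have "sat C \<Phi> (\<rho> i) = sat C \<Phi>' (\<rho> i)" "sat C \<Psi> (\<rho> i) = sat C \<Psi>' (\<rho> i)" for i
      using eq that[unfolded extent_eq_iff] by blast+
    then show "(\<exists>i. sat C \<Psi> (\<rho> i) \<and> (\<forall>j<i. sat C \<Phi> (\<rho> j))) =
      (\<exists>i. sat C \<Psi>' (\<rho> i) \<and> (\<forall>j<i. sat C \<Phi>' (\<rho> j)))" by simp
  qed
qed

lemma finite_sample_states: "is_sample S \<Longrightarrow> finite (sample_states S)"
  unfolding sample_states_def is_sample_def is_cgs_def by auto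

lemma small_formula:
  assumes S: "is_sample S" and \<Phi>: "\<Phi> \<in> sample_ATL Ops S"
  shows "\<exists>\<Psi>\<in>sample_ATL Ops S. extent S \<Psi> = extent S \<Phi> \<and>
    formula_size \<Psi> \<le> 2 ^ card (sample_states S)"
proof -
  let ?ATL = "ATL Ops (sample_agents S) (sample_props S)"
  define fam where "fam F \<longleftrightarrow> F \<subseteq> ?ATL \<and> (\<forall>\<Psi>\<in>F. subformulas \<Psi> \<subseteq> F) \<and> inj_on (extent S) F" for F
  have Pow: "finite (Pow (sample_states S))" "card (Pow (sample_states S)) = 2 ^ card (sample_states S)"
    using finite_sample_states[OF S] by (simp_all add: card_Pow)
  have ext: "extent S ` F \<subseteq> Pow (sample_states S)" for F unfolding extent_def by auto
  have bound: "finite F \<and> card F \<le> 2 ^ card (sample_states S)" if "fam F" for F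
  proof -
    have inj: "inj_on (extent S) F" using that by (simp add: fam_def)
    show ?thesis
      using card_inj_on_le[OF inj ext Pow(1)] inj_on_finite[OF inj ext Pow(1)] Pow(2) by simp
  qed
  have "fam {}" unfolding fam_def by simp
  then have "\<exists>F. fam F \<and> (\<forall>F'. fam F' \<longrightarrow> card F' \<le> card F)"
    by (rule ex_has_greatest_nat[where b = "Suc (2 ^ card (sample_states S))"])
      (use bound in \<open>auto simp: less_Suc_eq_le\<close>)
  then obtain F where F: "fam F" and max: "\<And>F'. fam F' \<Longrightarrow> card F' \<le> card F" by blast
  \<comment> \<open>An unrepresented formula whose proper subformulas lie in \<open>F\<close> could
    be added to \<open>F\<close>, contrary to maximality.\<close>
  have represented: "\<exists>\<Psi>'\<in>F. extent S \<Psi> = extent S \<Psi>'"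
    if "\<Psi> \<in> ?ATL" "subformulas \<Psi> \<subseteq> insert \<Psi> F" for \<Psi>
  proof (rule ccontr)
    assume new: "\<not> ?thesis"
    then have "\<Psi> \<notin> F" by blast
    have "inj_on (extent S) (insert \<Psi> F)"
      using F new unfolding inj_on_insert by (auto simp: fam_def)
    moreover have "\<forall>\<Psi>'\<in>insert \<Psi> F. subformulas \<Psi>' \<subseteq> insert \<Psi> F"
      using F that(2) by (simp add: fam_def subset_insertI2)
    moreover have "insert \<Psi> F \<subseteq> ?ATL" using F that(1) by (simp add: fam_def)
    ultimately have "fam (insert \<Psi> F)" by (simp add: fam_def)
    from max[OF this] \<open>\<Psi> \<notin> F\<close> bound[OF F] show False by simp
  qed
  have sub: "\<And>\<Psi>. \<Psi> \<in> F \<Longrightarrow> \<Psi> \<in> ?ATL \<and> subformulas \<Psi> \<subseteq> F" using F unfolding fam_def by blast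
  note cong = extent_cong[OF S]
  \<comment> \<open>Arguments are first replaced by their representatives in \<open>F\<close>, which
    keeps the extent by \<open>cong\<close>; the formula built from representatives has its proper
    subformulas in \<open>F\<close>, so \<open>represented\<close> applies.\<close>
  have "\<exists>\<Psi>\<in>F. extent S \<Phi> = extent S \<Psi>"
    using \<Phi> unfolding sample_ATL_def
  proof induction
    case (1 p)
    then show ?case by (intro represented ATL.intros) auto
  next
    case (2 \<Phi>)
    then obtain \<Phi>' where \<Phi>': "\<Phi>' \<in> F" "extent S \<Phi> = extent S \<Phi>'" by blast
    show ?case unfolding cong(1)[OF \<Phi>'(2)]
      by (rule represented) (use 2 sub[OF \<Phi>'(1)] in \<open>auto intro: ATL.intros\<close>)
  next
    case (3 \<Phi> \<Psi>)
    then obtain \<Phi>' \<Psi>' where \<Phi>': "\<Phi>' \<in> F" "extent S \<Phi> = extent S \<Phi>'"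
      and \<Psi>': "\<Psi>' \<in> F" "extent S \<Psi> = extent S \<Psi>'" by blast
    show ?case unfolding cong(2)[OF \<Phi>'(2) \<Psi>'(2)]
      by (rule represented) (use 3 sub[OF \<Phi>'(1)] sub[OF \<Psi>'(1)] in \<open>auto intro: ATL.intros\<close>)
  next
    case (4 A \<Phi>)
    then obtain \<Phi>' where \<Phi>': "\<Phi>' \<in> F" "extent S \<Phi> = extent S \<Phi>'" by blast
    show ?case unfolding cong(3)[OF \<Phi>'(2)]
      by (rule represented) (use 4 sub[OF \<Phi>'(1)] in \<open>auto intro: ATL.intros\<close>)
  next
    case (5 A \<Phi>)
    then obtain \<Phi>' where \<Phi>': "\<Phi>' \<in> F" "extent S \<Phi> = extent S \<Phi>'" by blast
    show ?case unfolding cong(4)[OF \<Phi>'(2)]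
      by (rule represented) (use 5 sub[OF \<Phi>'(1)] in \<open>auto intro: ATL.intros\<close>)
  next
    case (6 A \<Phi> \<Psi>)
    then obtain \<Phi>' \<Psi>' where \<Phi>': "\<Phi>' \<in> F" "extent S \<Phi> = extent S \<Phi>'"
      and \<Psi>': "\<Psi>' \<in> F" "extent S \<Psi> = extent S \<Psi>'" by blast
    show ?case unfolding cong(5)[OF \<Phi>'(2) \<Psi>'(2)]
      by (rule represented) (use 6 sub[OF \<Phi>'(1)] sub[OF \<Psi>'(1)] in \<open>auto intro: ATL.intros\<close>)
  qed
  then obtain \<Psi> where \<Psi>: "\<Psi> \<in> F" "extent S \<Phi> = extent S \<Psi>" by blast
  \<comment> \<open>The size counts distinct subformulas, and those of a member of \<open>F\<close>
    are themselves members.\<close>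
  have "formula_size \<Psi> \<le> card F" unfolding formula_size_def
    using sub[OF \<Psi>(1)] bound[OF F] by (auto intro: card_mono)
  with \<Psi> sub[OF \<Psi>(1)] bound[OF F] show ?thesis unfolding sample_ATL_def by (metis le_trans)
qed

section \<open>The decision program\<close>

abbreviation "TrueE \<equiv> NodeE LeafE LeafE"

text \<open>The accessors follow the layout of \<open>enc_cgs\<close> and \<open>enc_state\<close>.\<close>

abbreviation "propsE c \<equiv> LeftE (RightE c)"
abbreviation "statesE c \<equiv> LeftE (RightE (RightE c))"
abbreviation "initE q \<equiv> LeftE q"
abbreviation "labelE q \<equiv> LeftE (RightE q)"
abbreviation "movesE q \<equiv> LeftE (RightE (RightE (RightE q)))"

abbreviation "nat_eqE x y \<equiv> Call 1 [x, y]"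
abbreviation "memberE x ys \<equiv> Call 2 [x, ys]"
abbreviation "lookupE v r \<equiv> Call 3 [v, r]"
abbreviation "agreeE A \<alpha> \<beta> \<equiv> Call 4 [A, \<alpha>, \<beta>]"
abbreviation "forallE A \<beta> ms v \<equiv> Call 5 [A, \<beta>, ms, v]"
abbreviation "existsE A ms' ms v \<equiv> Call 6 [A, ms', ms, v]"
abbreviation "preE qs A u v Cs \<equiv> Call 7 [qs, A, u, v, Cs]"
abbreviation "andE v w \<equiv> Call 8 [v, w]"
abbreviation "orE v w \<equiv> Call 9 [v, w]"
abbreviation "notE v \<equiv> Call 10 [v]"
abbreviation "propE qs p Cs \<equiv> Call 11 [qs, p, Cs]"
abbreviation "globallyE n Cs A v \<equiv> Call 12 [n, Cs, A, v]"
abbreviation "untilE n Cs A v w \<equiv> Call 13 [n, Cs, A, v, w]"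
abbreviation "insertE v T \<equiv> Call 14 [v, T]"
abbreviation "lookup_trieE v T \<equiv> Call 15 [v, T]"
abbreviation "operatorsE A v w T Cs n \<equiv> Call 16 [A, v, w, T, Cs, n]"
abbreviation "coalitionsE k A v w T Cs n \<equiv> Call 17 [k, A, v, w, T, Cs, n]"
abbreviation "secondE m w v T Cs n k \<equiv> Call 18 [m, w, v, T, Cs, n, k]"
abbreviation "firstE m v T Cs n k \<equiv> Call 19 [m, v, T, Cs, n, k]"
abbreviation "roundsE m T Cs n k \<equiv> Call 20 [m, T, Cs, n, k]"
abbreviation "atomsE ps T Ds Cs \<equiv> Call 21 [ps, T, Ds, Cs]"
abbreviation "initsE qs v \<equiv> Call 22 [qs, v]"
abbreviation "dropE qs v \<equiv> Call 23 [qs, v]"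
abbreviation "positiveE Ps v Ns \<equiv> Call 24 [Ps, v, Ns]"
abbreviation "negativeE Ns v \<equiv> Call 25 [Ns, v]"
abbreviation "searchE m v T Ps Ns \<equiv> Call 26 [m, v, T, Ps, Ns]"
abbreviation "appendE xs ys \<equiv> Call 27 [xs, ys]"

definition nat_eq_body :: expr where
  "nat_eq_body = IfLeaf (Arg 0) (IfLeaf (Arg 1) TrueE LeafE)
     (IfLeaf (Arg 1) LeafE (nat_eqE (RightE (Arg 0)) (RightE (Arg 1))))"

definition member_body :: expr where
  "member_body = IfLeaf (Arg 1) LeafE
     (IfLeaf (nat_eqE (Arg 0) (LeftE (Arg 1))) (memberE (Arg 0) (RightE (Arg 1))) TrueE)"

definition lookup_body :: expr where
  "lookup_body = IfLeaf (Arg 1) (LeftE (Arg 0)) (lookupE (RightE (Arg 0)) (RightE (Arg 1)))"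

definition agree_body :: expr where
  "agree_body =
     (let rec = agreeE (RightE (Arg 0)) (RightE (Arg 1)) (RightE (Arg 2))
      in IfLeaf (Arg 0) TrueE (IfLeaf (LeftE (Arg 0)) rec
           (IfLeaf (nat_eqE (LeftE (Arg 1)) (LeftE (Arg 2))) LeafE rec)))"

definition forall_body :: expr where
  "forall_body =
     (let rec = forallE (Arg 0) (Arg 1) (RightE (Arg 2)) (Arg 3)
      in IfLeaf (Arg 2) TrueE (IfLeaf (agreeE (Arg 0) (LeftE (LeftE (Arg 2))) (Arg 1)) rec
           (IfLeaf (lookupE (Arg 3) (RightE (LeftE (Arg 2)))) LeafE rec)))"

text \<open>The move list is passed twice: one copy is used up by the candidates of the coalition,
  the other stays complete for the replies.\<close>

definition exists_body :: expr where
  "exists_body = IfLeaf (Arg 1) LeafE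
     (IfLeaf (forallE (Arg 0) (LeftE (LeftE (Arg 1))) (Arg 2) (Arg 3))
       (existsE (Arg 0) (RightE (Arg 1)) (Arg 2) (Arg 3)) TrueE)"

text \<open>
  The third argument is the vector from the start of the current structure on, into which the
  ranks of successor states are indices; the fourth is the part of the vector still to be used up.
\<close>

definition pre_body :: expr where
  "pre_body = IfLeaf (Arg 0)
     (IfLeaf (Arg 4) LeafE
       (preE (statesE (LeftE (Arg 4))) (Arg 1) (Arg 3) (Arg 3) (RightE (Arg 4))))
     (NodeE (existsE (Arg 1) (movesE (LeftE (Arg 0))) (movesE (LeftE (Arg 0))) (Arg 2))
       (preE (RightE (Arg 0)) (Arg 1) (Arg 2) (RightE (Arg 3)) (Arg 4)))"

definition and_body :: expr where
  "and_body = IfLeaf (Arg 0) LeafE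
     (NodeE (IfLeaf (LeftE (Arg 0)) LeafE (LeftE (Arg 1))) (andE (RightE (Arg 0)) (RightE (Arg 1))))"

definition or_body :: expr where
  "or_body = IfLeaf (Arg 0) LeafE
     (NodeE (IfLeaf (LeftE (Arg 0)) (LeftE (Arg 1)) TrueE) (orE (RightE (Arg 0)) (RightE (Arg 1))))"

definition not_body :: expr where
  "not_body = IfLeaf (Arg 0) LeafE
     (NodeE (IfLeaf (LeftE (Arg 0)) TrueE LeafE) (notE (RightE (Arg 0))))"

definition prop_body :: expr where
  "prop_body = IfLeaf (Arg 0)
     (IfLeaf (Arg 2) LeafE (propE (statesE (LeftE (Arg 2))) (Arg 1) (RightE (Arg 2))))
     (NodeE (memberE (Arg 1) (labelE (LeftE (Arg 0)))) (propE (RightE (Arg 0)) (Arg 1) (Arg 2)))"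

text \<open>The counter is a list of which only the length counts, so a bit vector can serve. The
  empty state list sends \<open>preE\<close> directly to the first structure.\<close>

definition globally_body :: expr where
  "globally_body = IfLeaf (Arg 0) (Arg 3)
     (andE (Arg 3) (preE LeafE (Arg 2) LeafE
       (globallyE (RightE (Arg 0)) (Arg 1) (Arg 2) (Arg 3)) (Arg 1)))"

definition until_body :: expr where
  "until_body = IfLeaf (Arg 0) (Arg 4)
     (orE (Arg 4) (andE (Arg 3) (preE LeafE (Arg 2) LeafE
       (untilE (RightE (Arg 0)) (Arg 1) (Arg 2) (Arg 3) (Arg 4)) (Arg 1))))"

text \<open>Since \<open>left\<close> and \<open>right\<close> map \<open>Leaf\<close> to
  \<open>Leaf\<close>, a missing branch needs no case of its own.\<close>

definition insert_body :: expr where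
  "insert_body = IfLeaf (Arg 0) TrueE (IfLeaf (LeftE (Arg 0))
     (NodeE (insertE (RightE (Arg 0)) (LeftE (Arg 1))) (RightE (Arg 1)))
     (NodeE (LeftE (Arg 1)) (insertE (RightE (Arg 0)) (RightE (Arg 1)))))"

definition lookup_trie_body :: expr where
  "lookup_trie_body = IfLeaf (Arg 0) (IfLeaf (Arg 1) LeafE TrueE)
     (lookup_trieE (RightE (Arg 0)) (IfLeaf (LeftE (Arg 0)) (LeftE (Arg 1)) (RightE (Arg 1))))"

definition insert_if :: "bool \<Rightarrow> expr \<Rightarrow> expr \<Rightarrow> expr" where
  "insert_if b v T = (if b then insertE v T else T)"

text \<open>The fragment is fixed before the program runs: it selects the code and is not part of
  the input.\<close>

definition operators_body :: "atl_op set \<Rightarrow> expr" where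
  "operators_body Ops =
     insert_if (OpU \<in> Ops) (untilE (Arg 5) (Arg 4) (Arg 0) (Arg 1) (Arg 2))
    (insert_if (OpG \<in> Ops) (globallyE (Arg 5) (Arg 4) (Arg 0) (Arg 1))
    (insert_if (OpX \<in> Ops) (preE LeafE (Arg 0) LeafE (Arg 1) (Arg 4))
    (insert_if (OpAnd \<in> Ops) (andE (Arg 1) (Arg 2))
    (insert_if (OpNot \<in> Ops) (notE (Arg 1)) (Arg 3)))))"

text \<open>The call for \<open>False\<close> is an argument of the call for \<open>True\<close>.
  Arguments are evaluated before a call is entered, so the two halves are not nested in each other
  and each bit costs one level of depth. \<open>second_body\<close>, \<open>first_body\<close> and
  \<open>rounds_body\<close> use the same device.\<close>

definition coalitions_body :: expr where
  "coalitions_body = IfLeaf (Arg 0)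
     (operatorsE (Arg 1) (Arg 2) (Arg 3) (Arg 4) (Arg 5) (Arg 6))
     (coalitionsE (RightE (Arg 0)) (NodeE TrueE (Arg 1)) (Arg 2) (Arg 3)
       (coalitionsE (RightE (Arg 0)) (NodeE LeafE (Arg 1)) (Arg 2) (Arg 3) (Arg 4) (Arg 5) (Arg 6))
       (Arg 5) (Arg 6))"

definition second_body :: expr where
  "second_body = IfLeaf (Arg 0)
     (IfLeaf (lookup_trieE (Arg 1) (Arg 3)) (Arg 3)
       (coalitionsE (Arg 6) LeafE (Arg 2) (Arg 1) (Arg 3) (Arg 4) (Arg 5)))
     (secondE (RightE (Arg 0)) (NodeE TrueE (Arg 1)) (Arg 2)
       (secondE (RightE (Arg 0)) (NodeE LeafE (Arg 1)) (Arg 2) (Arg 3) (Arg 4) (Arg 5) (Arg 6))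
       (Arg 4) (Arg 5) (Arg 6))"

definition first_body :: expr where
  "first_body = IfLeaf (Arg 0)
     (IfLeaf (lookup_trieE (Arg 1) (Arg 2)) (Arg 2)
       (secondE (Arg 4) LeafE (Arg 1) (Arg 2) (Arg 3) (Arg 4) (Arg 5)))
     (firstE (RightE (Arg 0)) (NodeE TrueE (Arg 1))
       (firstE (RightE (Arg 0)) (NodeE LeafE (Arg 1)) (Arg 2) (Arg 3) (Arg 4) (Arg 5))
       (Arg 3) (Arg 4) (Arg 5))"

text \<open>A counter of length \<open>m\<close> makes \<open>2\<^sup>m\<close> rounds.\<close>

definition rounds_body :: expr where
  "rounds_body = IfLeaf (Arg 0)
     (firstE (Arg 3) LeafE (Arg 1) (Arg 2) (Arg 3) (Arg 4))
     (roundsE (RightE (Arg 0)) (roundsE (RightE (Arg 0)) (Arg 1) (Arg 2) (Arg 3) (Arg 4))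
       (Arg 2) (Arg 3) (Arg 4))"

definition atoms_body :: expr where
  "atoms_body = IfLeaf (Arg 0)
     (IfLeaf (Arg 2) (Arg 1) (atomsE (propsE (LeftE (Arg 2))) (Arg 1) (RightE (Arg 2)) (Arg 3)))
     (atomsE (RightE (Arg 0)) (insertE (propE LeafE (LeftE (Arg 0)) (Arg 3)) (Arg 1)) (Arg 2) (Arg 3))"

definition inits_body :: expr where
  "inits_body =
     (let rec = initsE (RightE (Arg 0)) (RightE (Arg 1))
      in IfLeaf (Arg 0) TrueE (IfLeaf (initE (LeftE (Arg 0))) rec
           (IfLeaf (LeftE (Arg 1)) LeafE rec)))"

definition drop_body :: expr where
  "drop_body = IfLeaf (Arg 0) (Arg 1) (dropE (RightE (Arg 0)) (RightE (Arg 1)))"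

text \<open>The vector is consumed block by block, positive structures first; the remainder goes to
  the negative ones.\<close>

definition positive_body :: expr where
  "positive_body = IfLeaf (Arg 0) (negativeE (Arg 2) (Arg 1))
     (IfLeaf (initsE (statesE (LeftE (Arg 0))) (Arg 1)) LeafE
       (positiveE (RightE (Arg 0)) (dropE (statesE (LeftE (Arg 0))) (Arg 1)) (Arg 2)))"

definition negative_body :: expr where
  "negative_body = IfLeaf (Arg 0) TrueE
     (IfLeaf (initsE (statesE (LeftE (Arg 0))) (Arg 1))
       (negativeE (RightE (Arg 0)) (dropE (statesE (LeftE (Arg 0))) (Arg 1))) LeafE)"

definition search_body :: expr where
  "search_body = IfLeaf (Arg 0)
     (IfLeaf (lookup_trieE (Arg 1) (Arg 2)) LeafE (positiveE (Arg 3) (Arg 1) (Arg 4)))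
     (IfLeaf (searchE (RightE (Arg 0)) (NodeE TrueE (Arg 1)) (Arg 2) (Arg 3) (Arg 4))
       (searchE (RightE (Arg 0)) (NodeE LeafE (Arg 1)) (Arg 2) (Arg 3) (Arg 4)) TrueE)"

definition append_body :: expr where
  "append_body = IfLeaf (Arg 0) (Arg 1)
     (NodeE (LeftE (Arg 0)) (appendE (RightE (Arg 0)) (Arg 1)))"

text \<open>The vector of the proposition of rank 0 is computed for its length, the number of states
  of all structures; it is the counter for iterations, enumerations and rounds. The number of agents
  is read off the first structure.\<close>

definition main_body :: expr where
  "main_body =
     (let Cs = appendE (LeftE (Arg 0)) (RightE (Arg 0));
          n = propE LeafE LeafE Cs
      in searchE n LeafE (roundsE n (atomsE LeafE LeafE Cs Cs) Cs n (LeftE (LeftE Cs)))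
           (LeftE (Arg 0)) (RightE (Arg 0)))"

definition program :: "atl_op set \<Rightarrow> program" where
  "program Ops =
     [main_body, nat_eq_body, member_body, lookup_body, agree_body, forall_body, exists_body,
      pre_body, and_body, or_body, not_body, prop_body, globally_body, until_body, insert_body,
      lookup_trie_body, operators_body Ops, coalitions_body, second_body, first_body, rounds_body,
      atoms_body, inits_body, drop_body, positive_body, negative_body, search_body, append_body]"

lemma length_program: "length (program Ops) = 28"
  by (simp add: program_def)

lemma program_nth:
  "program Ops ! 0 = main_body" "program Ops ! Suc 0 = nat_eq_body" "program Ops ! 2 = member_body"
  "program Ops ! 3 = lookup_body" "program Ops ! 4 = agree_body" "program Ops ! 5 = forall_body"
  "program Ops ! 6 = exists_body" "program Ops ! 7 = pre_body" "program Ops ! 8 = and_body"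
  "program Ops ! 9 = or_body" "program Ops ! 10 = not_body" "program Ops ! 11 = prop_body"
  "program Ops ! 12 = globally_body" "program Ops ! 13 = until_body"
  "program Ops ! 14 = insert_body" "program Ops ! 15 = lookup_trie_body"
  "program Ops ! 16 = operators_body Ops" "program Ops ! 17 = coalitions_body"
  "program Ops ! 18 = second_body" "program Ops ! 19 = first_body" "program Ops ! 20 = rounds_body"
  "program Ops ! 21 = atoms_body" "program Ops ! 22 = inits_body" "program Ops ! 23 = drop_body"
  "program Ops ! 24 = positive_body" "program Ops ! 25 = negative_body"
  "program Ops ! 26 = search_body" "program Ops ! 27 = append_body"
  by (simp_all add: program_def)

lemmas program_simps = length_program program_nth Let_def

section \<open>Values of the auxiliary functions and sufficient call depths\<close>

abbreviation "calls Ops \<equiv> call (program Ops)"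
abbreviation "enc_vec v \<equiv> enc_list (map enc_bool v)"

lemma enc_bool_simps [simp]:
  "enc_bool True = Node Leaf Leaf" "enc_bool False = Leaf" "enc_bool b = Leaf \<longleftrightarrow> \<not> b"
  "enc_bool b = enc_bool c \<longleftrightarrow> b = c"
  by (simp_all add: enc_bool_def)

lemma enc_list_eq_Leaf [simp]: "enc_list xs = Leaf \<longleftrightarrow> xs = []"
  by (cases xs) simp_all

text \<open>The recursion stops at the smaller number, so a depth above the first argument
  suffices.\<close>

lemma call_nat_eq: "m < d \<Longrightarrow> calls Ops d (Suc 0) [enc_nat m, enc_nat n] = Some (enc_bool (m = n))"
proof (induction m arbitrary: n d)
  case 0
  then show ?case by (cases d; cases n) (simp_all add: program_simps nat_eq_body_def)
next
  case (Suc m)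
  then show ?case by (cases d; cases n) (simp_all add: program_simps nat_eq_body_def)
qed

lemma call_member:
  "x + length ys < d \<Longrightarrow>
     calls Ops d 2 [enc_nat x, enc_list (map enc_nat ys)] = Some (enc_bool (x \<in> set ys))"
proof (induction ys arbitrary: d)
  case Nil
  then show ?case by (cases d) (simp_all add: program_simps member_body_def)
next
  case (Cons y ys)
  then show ?case by (cases d) (auto simp: program_simps member_body_def call_nat_eq)
qed

lemma call_lookup:
  "r < length v \<Longrightarrow> r < d \<Longrightarrow> calls Ops d 3 [enc_vec v, enc_nat r] = Some (enc_bool (v ! r))"
proof (induction r arbitrary: v d)
  case 0
  then show ?case by (cases d; cases v) (simp_all add: program_simps lookup_body_def)
next
  case (Suc r)
  then show ?case by (cases d; cases v) (simp_all add: program_simps lookup_body_def)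
qed

definition agree :: "bool list \<Rightarrow> nat list \<Rightarrow> nat list \<Rightarrow> bool" where
  "agree As \<alpha> \<beta> \<longleftrightarrow> (\<forall>i<length As. As ! i \<longrightarrow> \<alpha> ! i = \<beta> ! i)"

lemma call_agree:
  assumes "length \<alpha> = length As" "length \<beta> = length As" "\<forall>x\<in>set \<alpha>. x \<le> B" "length As + B < d"
  shows "calls Ops d 4 [enc_vec As, enc_list (map enc_nat \<alpha>), enc_list (map enc_nat \<beta>)]
     = Some (enc_bool (agree As \<alpha> \<beta>))"
  using assms
proof (induction As arbitrary: \<alpha> \<beta> d)
  case Nil
  then show ?case by (cases d) (simp_all add: program_simps agree_body_def agree_def)
next
  case (Cons a As)
  obtain x \<alpha>' y \<beta>' d' where [simp]: "\<alpha> = x # \<alpha>'" "\<beta> = y # \<beta>'" "d = Suc d'"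
    using Cons.prems by (metis Suc_length_conv list.size(4) add_0_iff less_nat_zero_code not0_implies_Suc)
  from Cons.prems Cons.IH[of \<alpha>' \<beta>' d'] show ?case
    by (auto simp: program_simps agree_body_def agree_def call_nat_eq Let_def All_less_Suc2)
qed

lemma call_forall:
  assumes "\<forall>\<alpha>\<in>set ms. length \<alpha> = length As \<and> (\<forall>x\<in>set \<alpha>. x \<le> B) \<and> t \<alpha> < length v \<and> t \<alpha> \<le> B"
    and "length \<beta> = length As" "length ms + length As + B < d"
  shows "calls Ops d 5 [enc_vec As, enc_list (map enc_nat \<beta>),
       enc_list (map (\<lambda>\<alpha>. Node (enc_list (map enc_nat \<alpha>)) (enc_nat (t \<alpha>))) ms), enc_vec v]
     = Some (enc_bool (\<forall>\<alpha>\<in>set ms. agree As \<alpha> \<beta> \<longrightarrow> v ! t \<alpha>))"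
  using assms
proof (induction ms arbitrary: d)
  case Nil
  then show ?case by (cases d) (simp_all add: program_simps forall_body_def)
next
  case (Cons \<alpha> ms)
  then obtain d' where [simp]: "d = Suc d'" by (cases d) auto
  from Cons.prems Cons.IH[of d'] show ?case
    by (auto simp: program_simps forall_body_def call_agree[where B = B] call_lookup Let_def)
qed

lemma call_exists:
  assumes ms: "\<forall>\<alpha>\<in>set ms. length \<alpha> = length As \<and> (\<forall>x\<in>set \<alpha>. x \<le> B) \<and> t \<alpha> < length v \<and> t \<alpha> \<le> B"
    and "set ms' \<subseteq> set ms" "length ms' + length ms + length As + B < d"
  shows "calls Ops d 6 [enc_vec As,
       enc_list (map (\<lambda>\<alpha>. Node (enc_list (map enc_nat \<alpha>)) (enc_nat (t \<alpha>))) ms'),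
       enc_list (map (\<lambda>\<alpha>. Node (enc_list (map enc_nat \<alpha>)) (enc_nat (t \<alpha>))) ms), enc_vec v]
     = Some (enc_bool (\<exists>\<beta>\<in>set ms'. \<forall>\<alpha>\<in>set ms. agree As \<alpha> \<beta> \<longrightarrow> v ! t \<alpha>))"
  using assms(2-)
proof (induction ms' arbitrary: d)
  case Nil
  then show ?case by (cases d) (simp_all add: program_simps exists_body_def)
next
  case (Cons \<beta> ms')
  then obtain d' where [simp]: "d = Suc d'" by (cases d) auto
  from Cons.prems ms have "length \<beta> = length As" by auto
  with call_forall[OF ms this, of d'] Cons.prems Cons.IH[of d'] show ?case
    by (auto simp: program_simps exists_body_def)
qed

definition positions :: "cgs list \<Rightarrow> (cgs \<times> nat) list" where
  "positions Cs = concat (map (\<lambda>C. map (Pair C) (sorted_list_of_set (states C))) Cs)"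

lemma positions_simps [simp]:
  "positions [] = []"
  "positions (C # Cs) = map (Pair C) (sorted_list_of_set (states C)) @ positions Cs"
  by (simp_all add: positions_def)

text \<open>Numbers are unary and lists are traversed by recursion, so all these quantities enter
  the call depth.\<close>

definition bounded_cgs :: "nat \<Rightarrow> nat \<Rightarrow> cgs \<Rightarrow> bool" where
  "bounded_cgs k B C \<longleftrightarrow> is_cgs C \<and> nagents C = k \<and> card (states C) \<le> B \<and>
     (\<forall>q\<in>states C. length (moves_list C q) \<le> B \<and> card (label C q) \<le> B) \<and>
     (\<forall>q\<in>states C. \<forall>\<alpha>\<in>moves C q. \<forall>x\<in>set \<alpha>. x \<le> B)"

text \<open>This is \<open>pre\<close> as the program evaluates it: the coalition is a bit list, and
  \<open>v\<close> is the vector from the block of \<open>C\<close> on, indexed by ranks.\<close>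

definition pre_at :: "cgs \<Rightarrow> bool list \<Rightarrow> bool list \<Rightarrow> nat \<Rightarrow> bool" where
  "pre_at C As v q \<longleftrightarrow> (\<exists>\<beta>\<in>moves C q. \<forall>\<alpha>\<in>moves C q.
     agree As \<alpha> \<beta> \<longrightarrow> v ! rank (states C) (step C (q, \<alpha>)))"

primrec pre_vec :: "cgs list \<Rightarrow> bool list \<Rightarrow> bool list \<Rightarrow> bool list" where
  "pre_vec [] As v = []"
| "pre_vec (C # Cs) As v =
     map (pre_at C As v) (sorted_list_of_set (states C)) @ pre_vec Cs As (drop (card (states C)) v)"

lemma rank_less_card: "finite X \<Longrightarrow> x \<in> X \<Longrightarrow> rank X x < card X"
  unfolding rank_def by (rule psubset_card_mono) auto

lemma call_pre_at:
  assumes C: "bounded_cgs k B C" "q \<in> states C" and v: "card (states C) \<le> length v"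
    and k: "length As = k" "k \<le> B" and d: "4 * B < d"
  shows "calls Ops d 6 [enc_vec As, left (right (right (right (enc_state AP C q)))),
       left (right (right (right (enc_state AP C q)))), enc_vec v] = Some (enc_bool (pre_at C As v q))"
proof -
  have fin: "finite (states C)" and cgs: "is_cgs C"
    using C by (auto simp: bounded_cgs_def is_cgs_def)
  have "\<forall>\<alpha>\<in>set (moves_list C q). length \<alpha> = length As \<and> (\<forall>x\<in>set \<alpha>. x \<le> B) \<and>
      rank (states C) (step C (q, \<alpha>)) < length v \<and> rank (states C) (step C (q, \<alpha>)) \<le> B"
  proof
    fix \<alpha> assume "\<alpha> \<in> set (moves_list C q)"
    then have \<alpha>: "\<alpha> \<in> moves C q" by (simp add: set_moves_list)
    from rank_less_card[OF fin step_in_states[OF cgs C(2) this]] v C k \<alpha>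
    show "length \<alpha> = length As \<and> (\<forall>x\<in>set \<alpha>. x \<le> B) \<and>
      rank (states C) (step C (q, \<alpha>)) < length v \<and> rank (states C) (step C (q, \<alpha>)) \<le> B"
      by (auto simp: bounded_cgs_def moves_def)
  qed
  moreover have "length (moves_list C q) \<le> B" using C by (auto simp: bounded_cgs_def)
  ultimately show ?thesis using k d
    by (simp add: enc_state_def call_exists[where B = B and t = "\<lambda>\<alpha>. rank (states C) (step C (q, \<alpha>))"]
      set_moves_list pre_at_def)
qed

lemma left_right_enc_cgs [simp]:
  "left (enc_cgs AP C) = enc_nat (nagents C)"
  "left (right (enc_cgs AP C)) = enc_set AP (props C)"
  "left (right (right (enc_cgs AP C))) =
     enc_list (map (enc_state AP C) (sorted_list_of_set (states C)))"
  by (simp_all add: enc_cgs_def)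

text \<open>The two nested inductions follow the control flow: the inner one uses up the states of
  the current structure, the outer one moves to the next. \<open>u\<close> stays fixed meanwhile,
  while \<open>v\<close> loses one entry per state and so starts with the next block once
  \<open>qs\<close> is empty.\<close>

lemma call_pre:
  assumes "\<forall>q\<in>set qs. q \<in> states C \<and> bounded_cgs k B C \<and> card (states C) \<le> length u"
    and "\<forall>C\<in>set Cs. bounded_cgs k B C"
    and "length v = length qs + length (positions Cs)"
    and k: "length As = k" "k \<le> B"
    and "length qs + length (positions Cs) + length Cs + 4 * B < d"
  shows "calls Ops d 7 [enc_list (map (enc_state AP C) qs), enc_vec As, enc_vec u, enc_vec v,
       enc_list (map (enc_cgs AP) Cs)]
     = Some (enc_vec (map (pre_at C As u) qs @ pre_vec Cs As (drop (length qs) v)))"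
  using assms(1-3,6)
proof (induction Cs arbitrary: C qs u v d)
  case Nil
  then show ?case
  proof (induction qs arbitrary: v d)
    case Nil
    then show ?case by (cases d) (simp_all add: program_simps pre_body_def)
  next
    case (Cons q qs)
    then obtain d' b v' where [simp]: "d = Suc d'" "v = b # v'" by (cases d; cases v) auto
    from Cons.prems Cons.IH[of v' d'] show ?case
      by (simp add: program_simps pre_body_def call_pre_at[where k = k and B = B] k)
  qed
next
  case (Cons D Cs)
  show ?case using Cons.prems
  proof (induction qs arbitrary: v d)
    case Nil
    then obtain d' where [simp]: "d = Suc d'" by (cases d) auto
    have "finite (states D)" using Nil by (simp add: bounded_cgs_def is_cgs_def)
    with Nil Cons.IH[of "sorted_list_of_set (states D)" D v v d'] show ?case
      by (simp add: program_simps pre_body_def)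
  next
    case (Cons q qs)
    then obtain d' b v' where [simp]: "d = Suc d'" "v = b # v'" by (cases d; cases v) auto
    from Cons.prems Cons.IH[of v' d'] show ?case
      by (simp add: program_simps pre_body_def call_pre_at[where k = k and B = B] k)
  qed
qed

lemma call_and:
  "length v = length w \<Longrightarrow> length v < d \<Longrightarrow>
     calls Ops d 8 [enc_vec v, enc_vec w] = Some (enc_vec (map2 (\<and>) v w))"
proof (induction v w arbitrary: d rule: list_induct2)
  case Nil
  then show ?case by (cases d) (simp_all add: program_simps and_body_def)
next
  case (Cons x xs y ys)
  then show ?case by (cases d) (auto simp: program_simps and_body_def)
qed

lemma call_or:
  "length v = length w \<Longrightarrow> length v < d \<Longrightarrow>
     calls Ops d 9 [enc_vec v, enc_vec w] = Some (enc_vec (map2 (\<or>) v w))"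
proof (induction v w arbitrary: d rule: list_induct2)
  case Nil
  then show ?case by (cases d) (simp_all add: program_simps or_body_def)
next
  case (Cons x xs y ys)
  then show ?case by (cases d) (auto simp: program_simps or_body_def)
qed

lemma call_not:
  "length v < d \<Longrightarrow> calls Ops d 10 [enc_vec v] = Some (enc_vec (map Not v))"
proof (induction v arbitrary: d)
  case Nil
  then show ?case by (cases d) (simp_all add: program_simps not_body_def)
next
  case (Cons x v)
  then show ?case by (cases d) (auto simp: program_simps not_body_def)
qed

text \<open>The length is that of \<open>positions Cs\<close> even if \<open>r\<close> is the rank
  of no proposition, as may happen for the counter, which is the vector of rank 0.\<close>

definition prop_vec :: "nat set \<Rightarrow> cgs list \<Rightarrow> nat \<Rightarrow> bool list" where
  "prop_vec AP Cs r = map (\<lambda>(C, q). r \<in> rank AP ` label C q) (positions Cs)"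

lemma call_label:
  assumes "bounded_cgs k B C" "q \<in> states C" "r + B < d"
  shows "calls Ops d 2 [enc_nat r, left (right (enc_state AP C q))]
     = Some (enc_bool (r \<in> rank AP ` label C q))"
proof -
  have "label C q \<subseteq> props C" "finite (props C)" "card (label C q) \<le> B"
    using assms by (auto simp: bounded_cgs_def is_cgs_def)
  then have "finite (label C q)" "card (label C q) \<le> B" by (auto intro: finite_subset)
  then show ?thesis
    using assms(3) call_member[of r "map (rank AP) (sorted_list_of_set (label C q))" d Ops]
    by (simp add: enc_state_def enc_set_def comp_def)
qed

lemma call_prop:
  assumes "\<forall>q\<in>set qs. q \<in> states C \<and> bounded_cgs k B C"
    and "\<forall>C\<in>set Cs. bounded_cgs k B C"
    and "length qs + length (positions Cs) + length Cs + r + B < d"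
  shows "calls Ops d 11 [enc_list (map (enc_state AP C) qs), enc_nat r, enc_list (map (enc_cgs AP) Cs)]
     = Some (enc_vec (map (\<lambda>q. r \<in> rank AP ` label C q) qs @ prop_vec AP Cs r))"
  using assms
proof (induction Cs arbitrary: C qs d)
  case Nil
  then show ?case
  proof (induction qs arbitrary: d)
    case Nil
    then show ?case by (cases d) (simp_all add: program_simps prop_body_def prop_vec_def)
  next
    case (Cons q qs)
    then obtain d' where [simp]: "d = Suc d'" by (cases d) auto
    from Cons.prems Cons.IH[of d'] show ?case
      by (simp add: program_simps prop_body_def call_label[where k = k and B = B])
  qed
next
  case (Cons D Cs)
  show ?case using Cons.prems
  proof (induction qs arbitrary: d)
    case Nil
    then obtain d' where [simp]: "d = Suc d'" by (cases d) auto
    have "finite (states D)" using Nil by (simp add: bounded_cgs_def is_cgs_def)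
    with Nil Cons.IH[of "sorted_list_of_set (states D)" D d'] show ?case
      by (simp add: program_simps prop_body_def prop_vec_def comp_def)
  next
    case (Cons q qs)
    then obtain d' where [simp]: "d = Suc d'" by (cases d) auto
    from Cons.prems Cons.IH[of d'] show ?case
      by (simp add: program_simps prop_body_def call_label[where k = k and B = B])
  qed
qed

primrec globally_vec :: "cgs list \<Rightarrow> bool list \<Rightarrow> bool list \<Rightarrow> nat \<Rightarrow> bool list" where
  "globally_vec Cs As v 0 = v"
| "globally_vec Cs As v (Suc n) = map2 (\<and>) v (pre_vec Cs As (globally_vec Cs As v n))"

primrec until_vec :: "cgs list \<Rightarrow> bool list \<Rightarrow> bool list \<Rightarrow> bool list \<Rightarrow> nat \<Rightarrow> bool list" where
  "until_vec Cs As v w 0 = w"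
| "until_vec Cs As v w (Suc n) = map2 (\<or>) w (map2 (\<and>) v (pre_vec Cs As (until_vec Cs As v w n)))"

lemma length_pre_vec [simp]: "length (pre_vec Cs As v) = length (positions Cs)"
  by (induction Cs arbitrary: v) simp_all

lemma length_globally_vec [simp]:
  "length v = length (positions Cs) \<Longrightarrow> length (globally_vec Cs As v n) = length (positions Cs)"
  by (induction n) simp_all

lemma length_until_vec [simp]:
  "length v = length (positions Cs) \<Longrightarrow> length w = length (positions Cs) \<Longrightarrow>
     length (until_vec Cs As v w n) = length (positions Cs)"
  by (induction n) simp_all

text \<open>
  A set of vectors of one fixed length is a trie in which \<open>Leaf\<close> is the empty set and \<open>False\<close>
  leads to the left; \<open>insert_trie\<close> destroys tries of vectors of other lengths.
\<close>

primrec insert_trie :: "bool list \<Rightarrow> tree \<Rightarrow> tree" where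
  "insert_trie [] T = Node Leaf Leaf"
| "insert_trie (b # v) T = (if b then Node (left T) (insert_trie v (right T))
     else Node (insert_trie v (left T)) (right T))"

primrec in_trie :: "bool list \<Rightarrow> tree \<Rightarrow> bool" where
  "in_trie [] T \<longleftrightarrow> T \<noteq> Leaf"
| "in_trie (b # v) T \<longleftrightarrow> in_trie v (if b then right T else left T)"

lemma in_insert_trie:
  "length v = length w \<Longrightarrow> in_trie v (insert_trie w T) \<longleftrightarrow> v = w \<or> in_trie v T"
  by (induction v w arbitrary: T rule: list_induct2) auto

lemma not_in_trie_Leaf: "\<not> in_trie v Leaf"
  by (induction v) auto

lemma call_insert:
  "length v < d \<Longrightarrow> calls Ops d 14 [enc_vec v, T] = Some (insert_trie v T)"
proof (induction v arbitrary: T d)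
  case Nil
  then show ?case by (cases d) (simp_all add: program_simps insert_body_def)
next
  case (Cons x v)
  then show ?case by (cases d) (auto simp: program_simps insert_body_def)
qed

lemma call_lookup_trie:
  "length v < d \<Longrightarrow> calls Ops d 15 [enc_vec v, T] = Some (enc_bool (in_trie v T))"
proof (induction v arbitrary: T d)
  case Nil
  then show ?case by (cases d) (simp_all add: program_simps lookup_trie_body_def)
next
  case (Cons x v)
  then show ?case by (cases d) (auto simp: program_simps lookup_trie_body_def)
qed

text \<open>One list serves all operators: results of unary ones are found by pairing
  \<open>v\<close> with itself, and results of the boolean ones under any coalition.\<close>

definition operator_results ::
  "atl_op set \<Rightarrow> cgs list \<Rightarrow> bool list \<Rightarrow> bool list \<Rightarrow> bool list \<Rightarrow> bool list list" where
  "operator_results Ops Cs As v w =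
     (if OpNot \<in> Ops then [map Not v] else []) @
     (if OpAnd \<in> Ops then [map2 (\<and>) v w] else []) @
     (if OpX \<in> Ops then [pre_vec Cs As v] else []) @
     (if OpG \<in> Ops then [globally_vec Cs As v (length (positions Cs))] else []) @
     (if OpU \<in> Ops then [until_vec Cs As v w (length (positions Cs))] else [])"

text \<open>Bits are put in front, so the vectors visited are \<open>x @ u\<close> with
  \<open>length x = m\<close>. The trie is threaded through all visits, and later ones see the
  results of earlier ones.\<close>

primrec enumerate_vecs ::
  "nat \<Rightarrow> bool list \<Rightarrow> (bool list \<Rightarrow> tree \<Rightarrow> tree) \<Rightarrow> tree \<Rightarrow> tree" where
  "enumerate_vecs 0 u F T = F u T"
| "enumerate_vecs (Suc m) u F T =
     enumerate_vecs m (True # u) F (enumerate_vecs m (False # u) F T)"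

definition round :: "atl_op set \<Rightarrow> cgs list \<Rightarrow> nat \<Rightarrow> tree \<Rightarrow> tree" where
  "round Ops Cs k = enumerate_vecs (length (positions Cs)) [] (\<lambda>v T. if in_trie v T
     then enumerate_vecs (length (positions Cs)) [] (\<lambda>w T. if in_trie w T
       then enumerate_vecs k [] (\<lambda>As. fold insert_trie (operator_results Ops Cs As v w)) T
       else T) T
     else T)"

text \<open>\<open>zip\<close> stops at the end of the shorter list, so the blocks of later
  structures at the end of \<open>v\<close> are not looked at.\<close>

definition accepts :: "cgs \<Rightarrow> bool list \<Rightarrow> bool" where
  "accepts C v \<longleftrightarrow> (\<forall>(q, b)\<in>set (zip (sorted_list_of_set (states C)) v). q \<in> inits C \<longrightarrow> b)"

primrec check_negative :: "cgs list \<Rightarrow> bool list \<Rightarrow> bool" where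
  "check_negative [] v \<longleftrightarrow> True"
| "check_negative (C # Ns) v \<longleftrightarrow>
     \<not> accepts C v \<and> check_negative Ns (drop (card (states C)) v)"

primrec check :: "cgs list \<Rightarrow> cgs list \<Rightarrow> bool list \<Rightarrow> bool" where
  "check [] Ns v \<longleftrightarrow> check_negative Ns v"
| "check (C # Ps) Ns v \<longleftrightarrow> accepts C v \<and> check Ps Ns (drop (card (states C)) v)"

lemma call_inits:
  "length qs \<le> length v \<Longrightarrow> length qs < d \<Longrightarrow>
     calls Ops d 22 [enc_list (map (enc_state AP C) qs), enc_vec v]
       = Some (enc_bool (\<forall>(q, b)\<in>set (zip qs v). q \<in> inits C \<longrightarrow> b))"
proof (induction qs arbitrary: v d)
  case Nil
  then show ?case by (cases d) (simp_all add: program_simps inits_body_def)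
next
  case (Cons q qs)
  then obtain d' b v' where [simp]: "d = Suc d'" "v = b # v'" by (cases d; cases v) auto
  have [simp]: "left (enc_state AP C q) = enc_bool (q \<in> inits C)" by (simp add: enc_state_def)
  from Cons.prems Cons.IH[of v' d'] show ?case
    by (auto simp: program_simps inits_body_def Let_def)
qed

lemma call_drop:
  "length qs \<le> length v \<Longrightarrow> length qs < d \<Longrightarrow>
     calls Ops d 23 [enc_list (map (enc_state AP C) qs), enc_vec v] = Some (enc_vec (drop (length qs) v))"
proof (induction qs arbitrary: v d)
  case Nil
  then show ?case by (cases d) (simp_all add: program_simps drop_body_def)
next
  case (Cons q qs)
  then obtain d' b v' where [simp]: "d = Suc d'" "v = b # v'" by (cases d; cases v) auto
  from Cons.prems Cons.IH[of v' d'] show ?case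
    by (auto simp: program_simps drop_body_def)
qed

lemma call_negative:
  assumes "\<forall>C\<in>set Ns. is_cgs C" "length v = length (positions Ns)"
    and "length (positions Ns) + length Ns < d"
  shows "calls Ops d 25 [enc_list (map (enc_cgs AP) Ns), enc_vec v]
    = Some (enc_bool (check_negative Ns v))"
  using assms
proof (induction Ns arbitrary: v d)
  case Nil
  then show ?case by (cases d) (simp_all add: program_simps negative_body_def)
next
  case (Cons C Ns)
  then obtain d' where [simp]: "d = Suc d'" by (cases d) auto
  have "finite (states C)" using Cons by (simp add: is_cgs_def)
  with Cons show ?case
    by (simp add: program_simps negative_body_def call_inits call_drop accepts_def)
qed

lemma call_positive:
  assumes "\<forall>C\<in>set (Ps @ Ns). is_cgs C" "length v = length (positions (Ps @ Ns))"
    and "length (positions (Ps @ Ns)) + length (Ps @ Ns) + 1 < d"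
  shows "calls Ops d 24 [enc_list (map (enc_cgs AP) Ps), enc_vec v, enc_list (map (enc_cgs AP) Ns)]
    = Some (enc_bool (check Ps Ns v))"
  using assms
proof (induction Ps arbitrary: v d)
  case Nil
  then show ?case by (cases d) (simp_all add: program_simps positive_body_def call_negative)
next
  case (Cons C Ps)
  then obtain d' where [simp]: "d = Suc d'" by (cases d) auto
  have "finite (states C)" using Cons by (simp add: is_cgs_def)
  with Cons call_inits[of "sorted_list_of_set (states C)" v d' Ops AP C, folded accepts_def]
  show ?case by (auto simp: program_simps positive_body_def call_drop)
qed

lemma call_append:
  "length xs < d \<Longrightarrow> calls Ops d 27 [enc_list xs, enc_list ys] = Some (enc_list (xs @ ys))"
proof (induction xs arbitrary: d)
  case Nil
  then show ?case by (cases d) (simp_all add: program_simps append_body_def)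
next
  case (Cons x xs)
  then show ?case by (cases d) (simp_all add: program_simps append_body_def)
qed

section \<open>Operators on vectors\<close>

definition vec :: "cgs list \<Rightarrow> (cgs \<times> nat \<Rightarrow> bool) \<Rightarrow> bool list" where
  "vec Cs Z = map Z (positions Cs)"

lemma vec_simps [simp]:
  "vec [] Z = []"
  "vec (C # Cs) Z = map (\<lambda>q. Z (C, q)) (sorted_list_of_set (states C)) @ vec Cs Z"
  by (simp_all add: vec_def comp_def)

lemma length_vec [simp]: "length (vec Cs Z) = length (positions Cs)"
  by (simp add: vec_def)

lemma set_positions:
  "\<forall>C\<in>set Cs. is_cgs C \<Longrightarrow> set (positions Cs) = (SIGMA C:set Cs. states C)"
  by (auto simp: positions_def is_cgs_def)

text \<open>The elements below \<open>x\<close> are those at the indices before that of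
  \<open>x\<close>, so rank and index coincide. Hence the encoded successor of a move addresses the
  vector directly.\<close>

lemma nth_rank:
  assumes X: "finite X" "x \<in> X"
  shows "sorted_list_of_set X ! rank X x = x"
proof -
  let ?xs = "sorted_list_of_set X"
  obtain i where i: "i < length ?xs" "?xs ! i = x"
    using X by (metis in_set_conv_nth set_sorted_list_of_set)
  have s: "sorted_wrt (<) ?xs" by simp
  have "{y \<in> X. y < x} = (\<lambda>j. ?xs ! j) ` {..<i}"
  proof (intro equalityI subsetI)
    fix y assume "y \<in> {y \<in> X. y < x}"
    then obtain j where j: "j < length ?xs" "?xs ! j = y" "y < x"
      using X by (metis (no_types, lifting) in_set_conv_nth mem_Collect_eq set_sorted_list_of_set)
    have "j < i"
    proof (rule ccontr)
      assume "\<not> j < i"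
      then have "i = j \<or> i < j" by linarith
      then show False using sorted_wrt_nth_less[OF s, of i j] j i by auto
    qed
    with j show "y \<in> (\<lambda>j. ?xs ! j) ` {..<i}" by blast
  next
    fix y assume "y \<in> (\<lambda>j. ?xs ! j) ` {..<i}"
    then obtain j where j: "j < i" "y = ?xs ! j" by blast
    then have "y < x" using sorted_wrt_nth_less[OF s, of j i] i by simp
    moreover have "y \<in> X" using j i X nth_mem[of j ?xs] by simp
    ultimately show "y \<in> {y \<in> X. y < x}" by simp
  qed
  moreover have "inj_on (\<lambda>j. ?xs ! j) {..<i}"
    using i by (auto simp: inj_on_def nth_eq_iff_index_eq)
  ultimately have "rank X x = i" by (simp add: rank_def card_image)
  then show ?thesis using i by simp
qed

lemma rank_eq_iff: "finite X \<Longrightarrow> x \<in> X \<Longrightarrow> y \<in> X \<Longrightarrow> rank X x = rank X y \<longleftrightarrow> x = y"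
  by (metis nth_rank)

definition coalition_of :: "bool list \<Rightarrow> nat set" where
  "coalition_of As = {Suc i | i. i < length As \<and> As ! i}"

lemma agree_iff: "agree As \<alpha> \<beta> \<longleftrightarrow> (\<forall>a\<in>coalition_of As. act \<alpha> a = act \<beta> a)"
  by (auto simp: agree_def coalition_of_def act_def)

lemma coalition_of_subset: "length As = k \<Longrightarrow> coalition_of As \<subseteq> {1..k}"
  by (auto simp: coalition_of_def)

lemma ex_coalition_of:
  assumes "A \<subseteq> {1..k}"
  shows "\<exists>As. length As = k \<and> coalition_of As = A"
proof (intro exI conjI)
  show "coalition_of (map (\<lambda>i. Suc i \<in> A) [0..<k]) = A"
  proof (intro equalityI subsetI)
    fix a assume "a \<in> A"
    with assms obtain i where "a = Suc i" "i < k" by (cases a) auto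
    with \<open>a \<in> A\<close> show "a \<in> coalition_of (map (\<lambda>i. Suc i \<in> A) [0..<k])"
      by (auto simp: coalition_of_def)
  qed (auto simp: coalition_of_def)
qed simp

text \<open>The vector passed on for \<open>C\<close> begins with the block of \<open>C\<close>, and
  a rank is smaller than the number of states, so it never reaches into a later block.\<close>

lemma pre_vec_vec:
  assumes "\<forall>C\<in>set Cs. is_cgs C"
  shows "pre_vec Cs As (vec Cs Z) = vec Cs (\<lambda>(C, q). pre C (coalition_of As) (\<lambda>q. Z (C, q)) q)"
  using assms
proof (induction Cs)
  case (Cons C Cs)
  then have C: "is_cgs C" and fin: "finite (states C)" by (simp_all add: is_cgs_def)
  have "(map (\<lambda>q. Z (C, q)) (sorted_list_of_set (states C)) @ vec Cs Z) ! rank (states C) q = Z (C, q)"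
    if "q \<in> states C" for q
    using rank_less_card[OF fin that] nth_rank[OF fin that] by (simp add: nth_append)
  then have "pre_at C As (vec (C # Cs) Z) q = pre C (coalition_of As) (\<lambda>q. Z (C, q)) q"
    if "q \<in> states C" for q
    using step_in_states[OF C that] unfolding pre_at_def pre_def agree_iff by simp
  with Cons fin show ?case by simp
qed simp

lemma map2_vec: "map2 f (vec Cs Y) (vec Cs Z) = vec Cs (\<lambda>x. f (Y x) (Z x))"
  by (simp add: vec_def map2_map_map)

lemma globally_vec_vec:
  assumes "\<forall>C\<in>set Cs. is_cgs C"
  shows "globally_vec Cs As (vec Cs Z) n =
    vec Cs (\<lambda>(C, q). globally_iter C (coalition_of As) (\<lambda>q. Z (C, q)) n q)"
proof (induction n)
  case (Suc n)
  then show ?case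
    by (auto simp: pre_vec_vec[OF assms] map2_vec intro!: arg_cong[where f = "vec Cs"])
qed simp

lemma until_vec_vec:
  assumes "\<forall>C\<in>set Cs. is_cgs C"
  shows "until_vec Cs As (vec Cs Y) (vec Cs Z) n =
    vec Cs (\<lambda>(C, q). until_iter C (coalition_of As) (\<lambda>q. Y (C, q)) (\<lambda>q. Z (C, q)) n q)"
proof (induction n)
  case (Suc n)
  then show ?case
    by (auto simp: pre_vec_vec[OF assms] map2_vec intro!: arg_cong[where f = "vec Cs"])
qed simp

definition sat_vec :: "cgs list \<Rightarrow> atl \<Rightarrow> bool list" where
  "sat_vec Cs \<Phi> = vec Cs (\<lambda>(C, q). sat C \<Phi> q)"

lemma length_sat_vec [simp]: "length (sat_vec Cs \<Phi>) = length (positions Cs)"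
  by (simp add: sat_vec_def)

lemma card_states_le_positions:
  assumes "\<forall>C\<in>set Cs. is_cgs C" "C \<in> set Cs"
  shows "card (states C) \<le> length (positions Cs)"
  using assms by (induction Cs) (auto simp: is_cgs_def)

lemma vec_cong:
  assumes "\<forall>C\<in>set Cs. is_cgs C" "\<And>C q. C \<in> set Cs \<Longrightarrow> q \<in> states C \<Longrightarrow> Y (C, q) = Z (C, q)"
  shows "vec Cs Y = vec Cs Z"
  unfolding vec_def using assms(2) by (auto simp: set_positions[OF assms(1)])

lemma sat_vec_Neg: "map Not (sat_vec Cs \<Phi>) = sat_vec Cs (Neg \<Phi>)"
  by (simp add: sat_vec_def vec_def comp_def case_prod_unfold)

lemma sat_vec_Conj: "map2 (\<and>) (sat_vec Cs \<Phi>) (sat_vec Cs \<Psi>) = sat_vec Cs (Conj \<Phi> \<Psi>)"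
  by (auto simp: sat_vec_def map2_vec intro!: arg_cong[where f = "vec Cs"])

text \<open>Each structure has at most \<open>length (positions Cs)\<close> states, so the
  simultaneous iteration has stabilised in all of them.\<close>

lemma sat_vec_Enf:
  assumes Cs: "\<forall>C\<in>set Cs. is_cgs C" and k: "\<forall>C\<in>set Cs. nagents C = length As"
  shows "pre_vec Cs As (sat_vec Cs \<Phi>) = sat_vec Cs (EnfX (coalition_of As) \<Phi>)"
    and "globally_vec Cs As (sat_vec Cs \<Phi>) (length (positions Cs)) = sat_vec Cs (EnfG (coalition_of As) \<Phi>)"
    and "until_vec Cs As (sat_vec Cs \<Phi>) (sat_vec Cs \<Psi>) (length (positions Cs)) =
      sat_vec Cs (EnfU (coalition_of As) \<Phi> \<Psi>)"
proof -
  have A: "coalition_of As \<subseteq> agents C" if "C \<in> set Cs" for C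
    using coalition_of_subset[of As] k that by (simp add: agents_def)
  note n = card_states_le_positions[OF Cs]
  show "pre_vec Cs As (sat_vec Cs \<Phi>) = sat_vec Cs (EnfX (coalition_of As) \<Phi>)"
    unfolding sat_vec_def pre_vec_vec[OF Cs]
    by (intro vec_cong[OF Cs]) (use A Cs in \<open>simp add: sat_EnfX del: sat.simps\<close>)
  show "globally_vec Cs As (sat_vec Cs \<Phi>) (length (positions Cs)) = sat_vec Cs (EnfG (coalition_of As) \<Phi>)"
    unfolding sat_vec_def globally_vec_vec[OF Cs]
  proof (intro vec_cong[OF Cs])
    fix C q assume "C \<in> set Cs" "q \<in> states C"
    with sat_EnfG[OF _ A _ n] Cs
    show "(case (C, q) of (C, q) \<Rightarrow> globally_iter C (coalition_of As) (\<lambda>q. case (C, q) of (C, q) \<Rightarrow> sat C \<Phi> q) (length (positions Cs)) q) =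
        (case (C, q) of (C, q) \<Rightarrow> sat C (EnfG (coalition_of As) \<Phi>) q)" by (simp del: sat.simps)
  qed
  show "until_vec Cs As (sat_vec Cs \<Phi>) (sat_vec Cs \<Psi>) (length (positions Cs)) =
      sat_vec Cs (EnfU (coalition_of As) \<Phi> \<Psi>)"
    unfolding sat_vec_def until_vec_vec[OF Cs]
  proof (intro vec_cong[OF Cs])
    fix C q assume "C \<in> set Cs" "q \<in> states C"
    with sat_EnfU[OF _ A _ n] Cs
    show "(case (C, q) of (C, q) \<Rightarrow> until_iter C (coalition_of As)
        (\<lambda>q. case (C, q) of (C, q) \<Rightarrow> sat C \<Phi> q) (\<lambda>q. case (C, q) of (C, q) \<Rightarrow> sat C \<Psi> q)
        (length (positions Cs)) q) =
        (case (C, q) of (C, q) \<Rightarrow> sat C (EnfU (coalition_of As) \<Phi> \<Psi>) q)" by (simp del: sat.simps)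
  qed
qed

text \<open>Ranks are injective on \<open>AP\<close>, and all labels are subsets of
  \<open>AP\<close>.\<close>

lemma sat_vec_Prop:
  assumes AP: "finite AP" "r \<in> AP" and Cs: "\<forall>C\<in>set Cs. is_cgs C \<and> props C \<subseteq> AP"
  shows "prop_vec AP Cs (rank AP r) = sat_vec Cs (Prop r)"
  unfolding prop_vec_def vec_def[symmetric] sat_vec_def
proof (intro vec_cong)
  fix C q assume "C \<in> set Cs" "q \<in> states C"
  moreover from this Cs have "label C \<in> states C \<rightarrow>\<^sub>E Pow (props C)" "props C \<subseteq> AP"
    by (simp_all add: is_cgs_def)
  ultimately have "label C q \<subseteq> AP" by (blast dest: PiE_mem)
  with AP show "(case (C, q) of (C, q) \<Rightarrow> rank AP r \<in> rank AP ` label C q) =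
      (case (C, q) of (C, q) \<Rightarrow> sat C (Prop r) q)"
    by (auto simp: rank_eq_iff subset_iff)
qed (use Cs in blast)

lemma accepts_vec:
  assumes "is_cgs C"
  shows "accepts C (map (\<lambda>q. Z (C, q)) (sorted_list_of_set (states C)) @ v) \<longleftrightarrow> (\<forall>q\<in>inits C. Z (C, q))"
proof -
  have "finite (states C)" "inits C \<subseteq> states C" using assms by (auto simp: is_cgs_def)
  moreover have "zip xs (map f xs @ v) = map (\<lambda>q. (q, f q)) xs" for f :: "nat \<Rightarrow> bool" and xs
    by (induction xs) auto
  ultimately show ?thesis by (auto simp: accepts_def)
qed

lemma check_negative_vec:
  assumes "\<forall>C\<in>set Ns. is_cgs C"
  shows "check_negative Ns (vec Ns Z) \<longleftrightarrow> (\<forall>C\<in>set Ns. \<not> (\<forall>q\<in>inits C. Z (C, q)))"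
  using assms
proof (induction Ns)
  case (Cons C Ns)
  then have "finite (states C)" by (simp add: is_cgs_def)
  with Cons show ?case by (simp add: accepts_vec)
qed simp

lemma check_vec:
  assumes "\<forall>C\<in>set (Ps @ Ns). is_cgs C"
  shows "check Ps Ns (vec (Ps @ Ns) Z) \<longleftrightarrow>
    (\<forall>C\<in>set Ps. \<forall>q\<in>inits C. Z (C, q)) \<and> (\<forall>C\<in>set Ns. \<not> (\<forall>q\<in>inits C. Z (C, q)))"
  using assms
proof (induction Ps)
  case (Cons C Ps)
  then have "finite (states C)" by (simp add: is_cgs_def)
  with Cons show ?case by (simp add: accepts_vec)
qed (simp add: check_negative_vec)

lemma check_sat_vec:
  "\<forall>C\<in>set (Ps @ Ns). is_cgs C \<Longrightarrow>
     check Ps Ns (sat_vec (Ps @ Ns) \<Phi>) \<longleftrightarrow> consistent \<Phi> (set Ps, set Ns)"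
  unfolding sat_vec_def by (subst check_vec) (simp_all add: models_def)

section \<open>Saturation\<close>

definition elems :: "nat \<Rightarrow> tree \<Rightarrow> bool list set" where
  "elems n T = {v. length v = n \<and> in_trie v T}"

lemma elems_insert_trie: "length w = n \<Longrightarrow> elems n (insert_trie w T) = insert w (elems n T)"
  by (auto simp: elems_def in_insert_trie)

lemma elems_fold_insert_trie:
  "\<forall>v\<in>set vs. length v = n \<Longrightarrow> elems n (fold insert_trie vs T) = set vs \<union> elems n T"
  by (induction vs arbitrary: T) (auto simp: elems_insert_trie)

lemma enumerate_vecs_invariant:
  assumes "\<And>x T. length x = m \<Longrightarrow> I T \<Longrightarrow> I (F (x @ u) T)" and "I T"
  shows "I (enumerate_vecs m u F T)"
  using assms
proof (induction m arbitrary: u T)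
  case (Suc m)
  have "I (F (x @ b # u) T)" if "length x = m" "I T" for x b T
    using Suc.prems(1)[of "x @ [b]"] that by simp
  with Suc show ?case by simp
qed simp

lemma enumerate_vecs_mono:
  assumes "\<And>x T. length x = m \<Longrightarrow> elems n T \<subseteq> elems n (F (x @ u) T)"
  shows "elems n T \<subseteq> elems n (enumerate_vecs m u F T)"
  by (rule enumerate_vecs_invariant) (use assms in blast)+

text \<open>\<open>T'\<close> is the trie at the moment when \<open>x\<close> is visited: by
  monotonicity earlier elements survive until then, and what the visit yields survives to the
  end.\<close>

lemma enumerate_vecs_visits:
  assumes "\<And>x T. length x = m \<Longrightarrow> elems n T \<subseteq> elems n (F (x @ u) T)" and "length x = m"
  shows "\<exists>T'. elems n T \<subseteq> elems n T' \<and> elems n (F (x @ u) T') \<subseteq> elems n (enumerate_vecs m u F T)"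
  using assms
proof (induction m arbitrary: u x T)
  case (Suc m)
  have mono: "elems n T \<subseteq> elems n (F (x @ b # u) T)" if "length x = m" for x b T
    using Suc.prems(1)[of "x @ [b]"] that by simp
  \<comment> \<open>The bit chosen first ends up last, because later ones are put in front of it; it
    decides which half visits \<open>x\<close>.\<close>
  obtain y b where x: "x = y @ [b]" "length y = m"
    using Suc.prems(2) by (metis length_Suc_conv_rev)
  \<comment> \<open>The half for \<open>True\<close> starts from the result of the half for
    \<open>False\<close>.\<close>
  let ?T = "if b then enumerate_vecs m (False # u) F T else T"
  obtain T' where T': "elems n ?T \<subseteq> elems n T'"
    "elems n (F (y @ b # u) T') \<subseteq> elems n (enumerate_vecs m (b # u) F ?T)"
    using Suc.IH[of "b # u" y ?T] mono x(2) by blast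
  have en: "elems n T \<subseteq> elems n (enumerate_vecs m (c # u) F T)" for c T
    by (rule enumerate_vecs_mono) (rule mono)
  then have "elems n T \<subseteq> elems n ?T" by simp
  moreover have "elems n (enumerate_vecs m (b # u) F ?T) \<subseteq> elems n (enumerate_vecs (Suc m) u F T)"
    using en by (cases b) simp_all
  ultimately show ?case using T' x by (intro exI[of _ T']) auto
qed auto

lemma length_operator_results:
  assumes "length v = length (positions Cs)" "length w = length (positions Cs)"
    and "u \<in> set (operator_results Ops Cs As v w)"
  shows "length u = length (positions Cs)"
  using assms by (auto simp: operator_results_def split: if_splits)

lemma elems_operator_results:
  assumes "length v = length (positions Cs)" "length w = length (positions Cs)"
  shows "elems (length (positions Cs)) (fold insert_trie (operator_results Ops Cs As v w) T) =
    set (operator_results Ops Cs As v w) \<union> elems (length (positions Cs)) T"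
  using length_operator_results[OF assms] by (simp add: elems_fold_insert_trie)

context
  fixes Ops :: "atl_op set" and Cs :: "cgs list" and k n :: nat
  defines "n \<equiv> length (positions Cs)"
begin

definition round_second :: "bool list \<Rightarrow> bool list \<Rightarrow> tree \<Rightarrow> tree" where
  "round_second v = (\<lambda>w T. if in_trie w T
     then enumerate_vecs k [] (\<lambda>As. fold insert_trie (operator_results Ops Cs As v w)) T else T)"

definition round_first :: "bool list \<Rightarrow> tree \<Rightarrow> tree" where
  "round_first = (\<lambda>v T. if in_trie v T then enumerate_vecs n [] (round_second v) T else T)"

lemma round_eq: "round Ops Cs k = enumerate_vecs n [] round_first"
  unfolding round_def round_first_def round_second_def n_def ..

lemma round_second_mono:
  "length v = n \<Longrightarrow> length w = n \<Longrightarrow> elems n T \<subseteq> elems n (round_second v w T)"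
  unfolding round_second_def n_def
  by (auto simp: elems_operator_results intro!: subsetD[OF enumerate_vecs_mono])

lemma round_first_mono: "length v = n \<Longrightarrow> elems n T \<subseteq> elems n (round_first v T)"
  using enumerate_vecs_mono[of n n "round_second v" "[]" T] round_second_mono[of v]
  by (simp add: round_first_def)

lemma round_mono: "elems n T \<subseteq> elems n (round Ops Cs k T)"
  unfolding round_eq by (intro enumerate_vecs_mono) (simp add: round_first_mono)

text \<open>The three nested loops reach \<open>v\<close>, \<open>w\<close> and \<open>As\<close> at
  tries \<open>T1\<close>, \<open>T2\<close> and \<open>T3\<close> that may have grown since the
  round began; so the membership tests succeed, and the results survive to the end of the
  round.\<close>

lemma round_complete:
  assumes v: "v \<in> elems n T" and w: "w \<in> elems n T" and As: "length As = k"
  shows "set (operator_results Ops Cs As v w) \<subseteq> elems n (round Ops Cs k T)"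
proof -
  have len: "length v = n" "length w = n" using v w by (auto simp: elems_def)
  obtain T1 where T1: "elems n T \<subseteq> elems n T1"
    and 1: "elems n (round_first v T1) \<subseteq> elems n (round Ops Cs k T)"
    using enumerate_vecs_visits[of n n round_first "[]" v T] round_first_mono len
    unfolding round_eq by auto
  obtain T2 where T2: "elems n T1 \<subseteq> elems n T2"
    and 2: "elems n (round_second v w T2) \<subseteq> elems n (enumerate_vecs n [] (round_second v) T1)"
    using enumerate_vecs_visits[of n n "round_second v" "[]" w T1] round_second_mono len by auto
  obtain T3 where
    3: "elems n (fold insert_trie (operator_results Ops Cs As v w) T3) \<subseteq>
      elems n (enumerate_vecs k [] (\<lambda>As. fold insert_trie (operator_results Ops Cs As v w)) T2)"
    using enumerate_vecs_visits[of k n "\<lambda>As. fold insert_trie (operator_results Ops Cs As v w)" "[]" As T2]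
      As len unfolding n_def by (auto simp: elems_operator_results)
  have "in_trie v T1" "in_trie w T2" using v w T1 T2 by (auto simp: elems_def)
  then have "set (operator_results Ops Cs As v w) \<subseteq> elems n (round_second v w T2)"
    "elems n (round_first v T1) = elems n (enumerate_vecs n [] (round_second v) T1)"
    using 3 len unfolding n_def by (auto simp: round_second_def round_first_def elems_operator_results n_def)
  with 1 2 show ?thesis by blast
qed

text \<open>The tests \<open>in_trie\<close> ensure that operators are applied to members of
  \<open>R\<close> only, also when these were inserted during the same round.\<close>

lemma round_sound:
  assumes R: "\<And>v w As. v \<in> R \<Longrightarrow> w \<in> R \<Longrightarrow> length As = k \<Longrightarrow>
      set (operator_results Ops Cs As v w) \<subseteq> R"
    and T: "elems n T \<subseteq> R"
  shows "elems n (round Ops Cs k T) \<subseteq> R"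
proof -
  have 2: "elems n (round_second v w T) \<subseteq> R"
    if "elems n T \<subseteq> R" "length v = n" "length w = n" "v \<in> R" for v w T
  proof (cases "in_trie w T")
    case True
    with that have "w \<in> R" by (auto simp: elems_def)
    show ?thesis unfolding round_second_def if_P[OF True]
    proof (rule enumerate_vecs_invariant)
      fix As :: "bool list" and T :: tree
      assume "length As = k" "elems n T \<subseteq> R"
      with R[OF \<open>v \<in> R\<close> \<open>w \<in> R\<close>] that
      show "elems n (fold insert_trie (operator_results Ops Cs (As @ []) v w) T) \<subseteq> R"
        unfolding n_def by (simp add: elems_operator_results)
    qed (rule that)
  qed (use that in \<open>simp add: round_second_def\<close>)
  have 1: "elems n (round_first v T) \<subseteq> R" if "elems n T \<subseteq> R" "length v = n" for v T
  proof (cases "in_trie v T")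
    case True
    with that have "v \<in> R" by (auto simp: elems_def)
    show ?thesis unfolding round_first_def if_P[OF True]
      by (rule enumerate_vecs_invariant) (use 2 that \<open>v \<in> R\<close> in auto)
  qed (use that in \<open>simp add: round_first_def\<close>)
  show ?thesis unfolding round_eq by (rule enumerate_vecs_invariant) (use 1 T in auto)
qed

text \<open>\<open>round\<close> acts on tries, not on the sets they hold, so a repeated set is not
  argued to persist. One repetition is enough: there the set is closed by
  \<open>round_complete\<close>, hence contains the least closed set \<open>R\<close>, and all later
  sets contain it and stay within \<open>R\<close>.\<close>

lemma rounds_reach_fixpoint:
  assumes "\<And>v w As. v \<in> R \<Longrightarrow> w \<in> R \<Longrightarrow> length As = k \<Longrightarrow>
      set (operator_results Ops Cs As v w) \<subseteq> R"
    and "elems n T \<subseteq> R"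
    and least: "\<And>X. elems n T \<subseteq> X \<Longrightarrow> X \<subseteq> {v. length v = n} \<Longrightarrow>
      (\<And>v w As. v \<in> X \<Longrightarrow> w \<in> X \<Longrightarrow> length As = k \<Longrightarrow>
        set (operator_results Ops Cs As v w) \<subseteq> X) \<Longrightarrow> R \<subseteq> X"
  shows "elems n ((round Ops Cs k ^^ (2 ^ n)) T) = R"
proof (intro equalityI)
  define X where "X i = elems n ((round Ops Cs k ^^ i) T)" for i
  have mono: "X i \<subseteq> X (Suc i)" for i unfolding X_def using round_mono by simp
  have sound: "X i \<subseteq> R" for i
    unfolding X_def
  proof (induction i)
    case (Suc i)
    have "elems n (round Ops Cs k ((round Ops Cs k ^^ i) T)) \<subseteq> R"
      by (rule round_sound) (use assms(1) Suc in blast)+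
    then show ?case by simp
  qed (simp add: assms(2))
  then show "elems n ((round Ops Cs k ^^ (2 ^ n)) T) \<subseteq> R" unfolding X_def .
  have "{v. length v = n} = {v. set v \<subseteq> (UNIV :: bool set) \<and> length v = n}" by simp
  then have U: "finite {v :: bool list. length v = n}" "card {v :: bool list. length v = n} = 2 ^ n"
    using finite_lists_length_eq[of "UNIV :: bool set" n] card_lists_length_eq[of "UNIV :: bool set" n]
    by simp_all
  have "X i \<subseteq> {v. length v = n}" for i unfolding X_def elems_def by blast
  from chain_stabilizes[of "{v. length v = n}" X, OF U(1) this mono] U(2) obtain i where
    i: "i \<le> 2 ^ n" "X (Suc i) = X i" by auto
  have X_mono: "X i \<subseteq> X j" if "i \<le> j" for i j using that by (rule lift_Suc_mono_le[of X, OF mono])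
  have "R \<subseteq> X i"
  proof (rule least)
    show "elems n T \<subseteq> X i" using X_mono[of 0 i] by (simp add: X_def)
    show "X i \<subseteq> {v. length v = n}" unfolding X_def elems_def by blast
    show "set (operator_results Ops Cs As v w) \<subseteq> X i"
      if "v \<in> X i" "w \<in> X i" "length As = k" for v w As
      using round_complete[OF that[unfolded X_def]] i(2) by (simp add: X_def)
  qed
  with X_mono[OF i(1)] show "R \<subseteq> elems n ((round Ops Cs k ^^ (2 ^ n)) T)" unfolding X_def by blast
qed

end

section \<open>Sizes\<close>

lemma finite_moves: "finite (moves C q)"
  unfolding set_moves_list[symmetric] by simp

lemma length_moves_list: "length (moves_list C q) = card (moves C q)"
proof -
  have "distinct (moves_list C q)"
    unfolding moves_list_def by (rule distinct_product_lists) auto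
  then show ?thesis unfolding set_moves_list[symmetric] by (simp add: distinct_card)
qed

lemma card_Q_Act: "is_cgs C \<Longrightarrow> card (Q_Act C) = (\<Sum>q\<in>states C. card (moves C q))"
  unfolding Q_Act_def is_cgs_def by (simp add: finite_moves)

lemma card_moves_pos: "is_cgs C \<Longrightarrow> q \<in> states C \<Longrightarrow> 0 < card (moves C q)"
  using coalition.moves_nonempty[of C "{}" q] by (simp add: coalition_def card_gt_0_iff finite_moves)

lemma card_moves_le: "is_cgs C \<Longrightarrow> q \<in> states C \<Longrightarrow> card (moves C q) \<le> card (Q_Act C)"
  unfolding card_Q_Act by (rule member_le_sum) (auto simp: is_cgs_def)

lemma card_states_le: "is_cgs C \<Longrightarrow> card (states C) \<le> card (Q_Act C)"
  unfolding card_Q_Act using sum_mono[of "states C" "\<lambda>_. 1" "\<lambda>q. card (moves C q)"]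
  by (simp add: card_moves_pos Suc_le_eq)

text \<open>If all other agents play 1, distinct actions of one agent give distinct moves, so a
  state has at least as many moves as an agent has actions there.\<close>

lemma action_le:
  assumes C: "is_cgs C" "q \<in> states C" and \<alpha>: "\<alpha> \<in> moves C q" and x: "x \<in> set \<alpha>"
  shows "x \<le> card (moves C q)"
proof -
  from x \<alpha> obtain i where i: "i < nagents C" "x = \<alpha> ! i"
    by (auto simp: in_set_conv_nth moves_def)
  then have a: "Suc i \<in> agents C" by (simp add: agents_def)
  with \<alpha> have "act \<alpha> (Suc i) \<in> {1..nact C (q, Suc i)}" unfolding moves_def by blast
  with i have "x \<le> nact C (q, Suc i)" by (simp add: act_def)
  also have "\<dots> = card {1..nact C (q, Suc i)}" by simp
  also have "\<dots> \<le> card (moves C q)"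
  proof (rule card_inj_on_le)
    let ?f = "\<lambda>j. map (\<lambda>b. if b = Suc i then j else 1) [Suc 0..<Suc (nagents C)]"
    have "act (?f j) (Suc i) = j" for j using act_map[OF a] by simp
    then show "inj_on ?f {1..nact C (q, Suc i)}"
      by (intro inj_on_inverseI[where g = "\<lambda>\<alpha>. act \<alpha> (Suc i)"]) simp
    show "?f ` {1..nact C (q, Suc i)} \<subseteq> moves C q"
      using nact_pos[OF C] by (intro image_subsetI map_in_moves) auto
  qed (rule finite_moves)
  finally show ?thesis .
qed

text \<open>Size 0 excludes states, as each state has a move. Extensional functions on an empty
  domain are \<open>undefined\<close> everywhere, so the whole record is determined.\<close>

lemma cgs_size_0_unique:
  assumes "is_cgs C" "is_cgs D" "cgs_size C = 0" "cgs_size D = 0"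
  shows "C = D"
proof -
  have empty: "states C = {} \<and> inits C = {} \<and> nagents C = 0 \<and> props C = {} \<and>
      label C = (\<lambda>_. undefined) \<and> nact C = (\<lambda>_. undefined) \<and> step C = (\<lambda>_. undefined)"
    if C: "is_cgs C" "cgs_size C = 0" for C
  proof -
    have s: "states C = {}" using C card_states_le[OF C(1)] by (simp add: cgs_size_def is_cgs_def)
    moreover have "props C = {}" "nagents C = 0"
      using C by (simp_all add: cgs_size_def is_cgs_def agents_def)
    ultimately show ?thesis using C(1) by (auto simp: is_cgs_def Q_Act_def restrict_def)
  qed
  show ?thesis
    by (rule cgs.equality) (simp_all only: empty[OF assms(1,3)] empty[OF assms(2,4)], simp)
qed

lemma finite_all_cgs: "is_sample S \<Longrightarrow> finite (all_cgs S)"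
  by (simp add: is_sample_def)

lemma cgs_size_le: "is_sample S \<Longrightarrow> C \<in> all_cgs S \<Longrightarrow> cgs_size C \<le> sample_size S"
  unfolding sample_size_def by (rule member_le_sum) (auto intro: finite_all_cgs)

lemma sum_list_le_sample_size:
  assumes S: "is_sample S" and "distinct Cs" "set Cs \<subseteq> all_cgs S"
    and f: "\<And>C. C \<in> set Cs \<Longrightarrow> f C \<le> cgs_size C"
  shows "sum_list (map f Cs) \<le> sample_size S"
proof -
  have "sum_list (map f Cs) = sum f (set Cs)" using assms(2) by (simp add: sum_list_distinct_conv_sum_set)
  also have "\<dots> \<le> sum cgs_size (set Cs)" using f by (rule sum_mono)
  also have "\<dots> \<le> sample_size S" unfolding sample_size_def
    using assms(3) finite_all_cgs[OF S] by (intro sum_mono2) auto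
  finally show ?thesis .
qed

text \<open>Structures of positive size contribute at least 1 each to \<open>sample_size S\<close>;
  the summand 1 is for the only possible structure of size 0.\<close>

lemma length_le_sample_size:
  assumes S: "is_sample S" and Cs: "distinct Cs" "set Cs \<subseteq> all_cgs S"
  shows "length Cs \<le> sample_size S + 1"
proof -
  have cgs: "\<And>C. C \<in> set Cs \<Longrightarrow> is_cgs C" using S Cs(2) by (auto simp: is_sample_def)
  let ?Z = "{C \<in> set Cs. cgs_size C = 0}" and ?P = "{C \<in> set Cs. cgs_size C \<noteq> 0}"
  have "card ?Z \<le> Suc 0"
  proof (rule card_le_Suc0_iff_eq[THEN iffD2])
    show "\<forall>C\<in>?Z. \<forall>D\<in>?Z. C = D"
      by (intro ballI cgs_size_0_unique) (simp_all add: cgs)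
  qed simp
  moreover have "card ?P \<le> sample_size S"
  proof -
    have "card ?P = (\<Sum>C\<in>?P. 1)" by simp
    also have "\<dots> \<le> (\<Sum>C\<in>?P. cgs_size C)" by (rule sum_mono) auto
    also have "\<dots> \<le> sample_size S" unfolding sample_size_def
      using Cs finite_all_cgs[OF S] by (intro sum_mono2) auto
    finally show ?thesis .
  qed
  moreover have "set Cs = ?Z \<union> ?P" by blast
  then have "length Cs = card (?Z \<union> ?P)" using distinct_card[OF Cs(1)] by simp
  moreover have "card (?Z \<union> ?P) \<le> card ?Z + card ?P" by (rule card_Un_le)
  ultimately show ?thesis by linarith
qed

section \<open>Correctness of the program\<close>

text \<open>Both forms of the code become a \<open>fold\<close> over a list of at most one element,
  matching \<open>operator_results\<close> piece by piece.\<close>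

lemma ev_insert_if:
  assumes "ev F env v = Some (enc_vec x)" "ev F env T = Some T'"
    and "\<And>T. F 14 [enc_vec x, T] = Some (insert_trie x T)"
  shows "ev F env (insert_if b v T) = Some (fold insert_trie (if b then [x] else []) T')"
  using assms by (simp add: insert_if_def)

locale bounded_instance =
  fixes Ops :: "atl_op set" and AP :: "nat set" and Ps Ns :: "cgs list" and k B :: nat
  assumes bounded: "\<forall>C\<in>set (Ps @ Ns). bounded_cgs k B C"
    and positions_le: "length (positions (Ps @ Ns)) \<le> B"
    and length_le: "length (Ps @ Ns) \<le> B"
    and k_le: "k \<le> B"
    and k_eq: "Ps @ Ns = [] \<Longrightarrow> k = 0"
    and AP: "finite AP" "card AP \<le> B" "\<forall>C\<in>set (Ps @ Ns). props C \<subseteq> AP"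
    and props_le: "length (concat (map (\<lambda>C. sorted_list_of_set (props C)) (Ps @ Ns))) \<le> B"
begin

abbreviation "Cs \<equiv> Ps @ Ns"
abbreviation "n \<equiv> length (positions Cs)"
abbreviation "enc_Cs \<equiv> enc_list (map (enc_cgs AP) Cs)"

text \<open>Of the \<open>6 * B\<close>, four cover one evaluation of \<open>existsE\<close>, one
  the states and one the structures.\<close>

lemma call_pre_Cs:
  assumes "length v = n" "length As = k" "6 * B < d"
  shows "calls Ops d 7 [Leaf, enc_vec As, Leaf, enc_vec v, enc_Cs] = Some (enc_vec (pre_vec Cs As v))"
  using call_pre[of "[]" undefined k B "[]" Cs v As d Ops AP] assms bounded positions_le length_le k_le
  by simp

lemma call_prop_Cs:
  assumes "r \<le> B" "4 * B < d"
  shows "calls Ops d 11 [Leaf, enc_nat r, enc_Cs] = Some (enc_vec (prop_vec AP Cs r))"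
  using call_prop[of "[]" undefined k B Cs r d Ops AP] assms bounded positions_le length_le
  by simp

lemma call_globally:
  assumes "length v = n" "length As = k" "length m + 6 * B < d"
  shows "calls Ops d 12 [enc_vec m, enc_Cs, enc_vec As, enc_vec v]
    = Some (enc_vec (globally_vec Cs As v (length m)))"
  using assms(3)
proof (induction m arbitrary: d)
  case Nil
  then show ?case by (cases d) (simp_all add: program_simps globally_body_def)
next
  case (Cons x m)
  then obtain d' where [simp]: "d = Suc d'" by (cases d) auto
  have "calls Ops d' 12 [enc_vec m, enc_Cs, enc_vec As, enc_vec v]
    = Some (enc_vec (globally_vec Cs As v (length m)))" using Cons by simp
  moreover have "calls Ops d' 7 [Leaf, enc_vec As, Leaf, enc_vec (globally_vec Cs As v (length m)), enc_Cs]
    = Some (enc_vec (pre_vec Cs As (globally_vec Cs As v (length m))))"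
    using call_pre_Cs[of "globally_vec Cs As v (length m)" As d'] assms(1,2) Cons.prems by simp
  moreover have "n < d'" using positions_le Cons.prems by simp
  ultimately show ?case using assms(1)
    by (simp add: program_simps globally_body_def call_and del: map_append map_map positions_simps)
qed

lemma call_until:
  assumes "length v = n" "length w = n" "length As = k" "length m + 6 * B < d"
  shows "calls Ops d 13 [enc_vec m, enc_Cs, enc_vec As, enc_vec v, enc_vec w]
    = Some (enc_vec (until_vec Cs As v w (length m)))"
  using assms(4)
proof (induction m arbitrary: d)
  case Nil
  then show ?case by (cases d) (simp_all add: program_simps until_body_def)
next
  case (Cons x m)
  then obtain d' where [simp]: "d = Suc d'" by (cases d) auto
  have "calls Ops d' 13 [enc_vec m, enc_Cs, enc_vec As, enc_vec v, enc_vec w]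
    = Some (enc_vec (until_vec Cs As v w (length m)))" using Cons by simp
  moreover have "calls Ops d' 7 [Leaf, enc_vec As, Leaf, enc_vec (until_vec Cs As v w (length m)), enc_Cs]
    = Some (enc_vec (pre_vec Cs As (until_vec Cs As v w (length m))))"
    using call_pre_Cs[of "until_vec Cs As v w (length m)" As d'] assms(1-3) Cons.prems by simp
  moreover have "n < d'" using positions_le Cons.prems by simp
  ultimately show ?case using assms(1,2)
    by (simp add: program_simps until_body_def call_and call_or del: map_append map_map positions_simps)
qed

text \<open>The seventh \<open>B\<close> pays for the iterations of \<open>globallyE\<close> and
  \<open>untilE\<close>, whose counter has length \<open>n\<close>.\<close>

lemma call_operators:
  assumes v: "length v = n" "length w = n" "length m = n" and As: "length As = k" and d: "7 * B + 1 < d"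
  shows "calls Ops d 16 [enc_vec As, enc_vec v, enc_vec w, T, enc_Cs, enc_vec m]
    = Some (fold insert_trie (operator_results Ops Cs As v w) T)"
proof -
  obtain d' where [simp]: "d = Suc d'" and d': "7 * B < d'" using d by (cases d) auto
  have B: "n < d'" "6 * B < d'" "length m + 6 * B < d'" using d' positions_le v(3) by simp_all
  let ?env = "[enc_vec As, enc_vec v, enc_vec w, T, enc_Cs, enc_vec m]"
  have ins: "calls Ops d' 14 [enc_vec x, T] = Some (insert_trie x T)" if "length x = n" for x T
    using that B(1) by (intro call_insert) simp
  have "ev (calls Ops d') ?env (operators_body Ops)
      = Some (fold insert_trie (operator_results Ops Cs As v w) T)"
    unfolding operators_body_def operator_results_def fold_append comp_apply
  proof (intro ev_insert_if)
    show "ev (calls Ops d') ?env (Arg 3) = Some T" by simp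
    show "ev (calls Ops d') ?env (notE (Arg 1)) = Some (enc_vec (map Not v))"
      using call_not[of v d' Ops] v B by simp
    show "ev (calls Ops d') ?env (andE (Arg 1) (Arg 2)) = Some (enc_vec (map2 (\<and>) v w))"
      using call_and[of v w d' Ops] v B by simp
    show "ev (calls Ops d') ?env (preE LeafE (Arg 0) LeafE (Arg 1) (Arg 4))
        = Some (enc_vec (pre_vec Cs As v))"
      using call_pre_Cs[OF v(1) As B(2)] by simp
    show "ev (calls Ops d') ?env (globallyE (Arg 5) (Arg 4) (Arg 0) (Arg 1))
        = Some (enc_vec (globally_vec Cs As v n))"
      using call_globally[OF v(1) As B(3)] v(3) by simp
    show "ev (calls Ops d') ?env (untilE (Arg 5) (Arg 4) (Arg 0) (Arg 1) (Arg 2))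
        = Some (enc_vec (until_vec Cs As v w n))"
      using call_until[OF v(1,2) As B(3)] v(3) by simp
  qed (use v in \<open>auto intro!: ins simp del: map_map\<close>)
  then show ?thesis by (simp add: program_simps)
qed

lemma call_coalitions:
  assumes v: "length v = n" "length w = n" "length m = n"
    and "length As + j = k" "j + 7 * B + 2 < d"
  shows "calls Ops d 17 [enc_nat j, enc_vec As, enc_vec v, enc_vec w, T, enc_Cs, enc_vec m]
    = Some (enumerate_vecs j As (\<lambda>As. fold insert_trie (operator_results Ops Cs As v w)) T)"
  using assms(4,5)
proof (induction j arbitrary: As T d)
  case 0
  then obtain d' where [simp]: "d = Suc d'" by (cases d) auto
  show ?case using call_operators[OF v, of As d' T] 0
    by (simp add: program_simps coalitions_body_def)
next
  case (Suc j)
  then obtain d' where [simp]: "d = Suc d'" by (cases d) auto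
  show ?case using Suc.IH[of "True # As" d'] Suc.IH[of "False # As" d'] Suc.prems
    by (simp add: program_simps coalitions_body_def)
qed

text \<open>The depth of the enumeration of coalitions, at most \<open>8 * B + 2\<close>, grows by
  the length of the counter and one level for the last step. \<open>call_first\<close> and
  \<open>call_rounds\<close> continue this addition, up to \<open>11 * B + 6\<close> in
  \<open>call_main\<close>.\<close>

lemma call_second:
  assumes v: "length v = n" "length m = n"
    and "length w + length c = n" "length c + 8 * B + 3 < d"
  shows "calls Ops d 18 [enc_vec c, enc_vec w, enc_vec v, T, enc_Cs, enc_vec m, enc_nat k]
    = Some (enumerate_vecs (length c) w (round_second Ops Cs k v) T)"
  using assms(3,4)
proof (induction c arbitrary: w T d)
  case Nil
  then obtain d' where [simp]: "d = Suc d'" by (cases d) auto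
  have "length w < d'" using Nil positions_le by simp
  with call_coalitions[OF v(1) _ v(2), of w "[]" k d' T] Nil k_le show ?case
    by (simp add: program_simps second_body_def call_lookup_trie round_second_def)
next
  case (Cons x c)
  then obtain d' where [simp]: "d = Suc d'" by (cases d) auto
  show ?case using Cons.IH[of "True # w" d'] Cons.IH[of "False # w" d'] Cons.prems
    by (simp add: program_simps second_body_def)
qed

lemma call_first:
  assumes m: "length m = n" and "length v + length c = n" "length c + 9 * B + 4 < d"
  shows "calls Ops d 19 [enc_vec c, enc_vec v, T, enc_Cs, enc_vec m, enc_nat k]
    = Some (enumerate_vecs (length c) v (round_first Ops Cs k) T)"
  using assms(2,3)
proof (induction c arbitrary: v T d)
  case Nil
  then obtain d' where [simp]: "d = Suc d'" by (cases d) auto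
  have "length v < d'" using Nil positions_le by simp
  with call_second[of v m "[]" m d' T] Nil m positions_le show ?case
    by (simp add: program_simps first_body_def call_lookup_trie round_first_def)
next
  case (Cons x c)
  then obtain d' where [simp]: "d = Suc d'" by (cases d) auto
  show ?case using Cons.IH[of "True # v" d'] Cons.IH[of "False # v" d'] Cons.prems
    by (simp add: program_simps first_body_def)
qed

lemma call_rounds:
  assumes m: "length m = n" and "length c + 10 * B + 5 < d"
  shows "calls Ops d 20 [enc_vec c, T, enc_Cs, enc_vec m, enc_nat k]
    = Some ((round Ops Cs k ^^ (2 ^ length c)) T)"
  using assms(2)
proof (induction c arbitrary: T d)
  case Nil
  then obtain d' where [simp]: "d = Suc d'" by (cases d) auto
  show ?case using call_first[OF m, of "[]" m d' T] Nil m positions_le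
    by (simp add: program_simps rounds_body_def round_eq)
next
  case (Cons x c)
  then obtain d' where [simp]: "d = Suc d'" by (cases d) auto
  show ?case using Cons.IH[of d'] Cons.prems
    by (simp add: program_simps rounds_body_def mult_2 funpow_add)
qed

lemma call_atoms:
  assumes "set ps \<subseteq> AP" "set Ds \<subseteq> set Cs"
    and "length (ps @ concat (map (\<lambda>C. sorted_list_of_set (props C)) Ds)) + length Ds + 4 * B + 1 < d"
  shows "calls Ops d 21 [enc_list (map (\<lambda>p. enc_nat (rank AP p)) ps), T,
      enc_list (map (enc_cgs AP) Ds), enc_Cs]
    = Some (fold (\<lambda>p. insert_trie (prop_vec AP Cs (rank AP p)))
        (ps @ concat (map (\<lambda>C. sorted_list_of_set (props C)) Ds)) T)"
  using assms
proof (induction Ds arbitrary: ps T d)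
  case Nil
  then show ?case
  proof (induction ps arbitrary: T d)
    case Nil
    then show ?case by (cases d) (simp_all add: program_simps atoms_body_def)
  next
    case (Cons p ps)
    then obtain d' where [simp]: "d = Suc d'" by (cases d) auto
    have "rank AP p \<le> B" using rank_less_card[OF AP(1), of p] AP(2) Cons.prems by simp
    with call_prop_Cs[of "rank AP p" d'] Cons.prems positions_le
      call_insert[of "prop_vec AP Cs (rank AP p)" d' Ops T] Cons.IH[of d']
    show ?case by (simp add: program_simps atoms_body_def prop_vec_def)
  qed
next
  case (Cons D Ds)
  have D: "props D \<subseteq> AP" using Cons.prems AP(3) by auto
  show ?case using Cons.prems
  proof (induction ps arbitrary: T d)
    case Nil
    then obtain d' where [simp]: "d = Suc d'" by (cases d) auto
    have "set (sorted_list_of_set (props D)) \<subseteq> AP"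
      using D finite_subset[OF D AP(1)] by simp
    with Nil Cons.IH[of "sorted_list_of_set (props D)" d' T] show ?case
      by (simp add: program_simps atoms_body_def enc_set_def)
  next
    case (Cons p ps)
    then obtain d' where [simp]: "d = Suc d'" by (cases d) auto
    have "rank AP p \<le> B" using rank_less_card[OF AP(1), of p] AP(2) Cons.prems by simp
    with call_prop_Cs[of "rank AP p" d'] Cons.prems positions_le
      call_insert[of "prop_vec AP Cs (rank AP p)" d' Ops T] Cons.IH[of d']
    show ?case by (simp add: program_simps atoms_body_def prop_vec_def)
  qed
qed

lemma call_search:
  assumes "length v + length c = n" "length c + 2 * B + 2 < d"
  shows "calls Ops d 26 [enc_vec c, enc_vec v, T, enc_list (map (enc_cgs AP) Ps),
      enc_list (map (enc_cgs AP) Ns)]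
    = Some (enc_bool (\<exists>x. length x = length c \<and> in_trie (x @ v) T \<and> check Ps Ns (x @ v)))"
  using assms
proof (induction c arbitrary: v d)
  case Nil
  then obtain d' where [simp]: "d = Suc d'" by (cases d) auto
  have "length v < d'" using Nil positions_le by simp
  moreover have "calls Ops d' 24 [enc_list (map (enc_cgs AP) Ps), enc_vec v, enc_list (map (enc_cgs AP) Ns)]
    = Some (enc_bool (check Ps Ns v))"
    by (rule call_positive) (use Nil bounded positions_le length_le in \<open>auto simp: bounded_cgs_def\<close>)
  ultimately show ?case
    by (simp add: program_simps search_body_def call_lookup_trie)
next
  case (Cons y c)
  then obtain d' where [simp]: "d = Suc d'" by (cases d) auto
  define E where "E u \<longleftrightarrow> (\<exists>x. length x = length c \<and> in_trie (x @ u) T \<and> check Ps Ns (x @ u))" for u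
  \<comment> \<open>Bits are put in front of \<open>v\<close>, so a solution is split at its last
    bit.\<close>
  have "(\<exists>x. length x = length (y # c) \<and> in_trie (x @ v) T \<and> check Ps Ns (x @ v)) \<longleftrightarrow>
      E (True # v) \<or> E (False # v)"
    unfolding E_def length_Cons length_Suc_conv_rev by (auto simp: ex_bool_eq)
  then show ?case
    using Cons.IH[of "True # v" d', folded E_def] Cons.IH[of "False # v" d', folded E_def] Cons.prems
    by (auto simp: program_simps search_body_def)
qed

definition atoms :: tree where
  "atoms = fold (\<lambda>p. insert_trie (prop_vec AP Cs (rank AP p)))
     (concat (map (\<lambda>C. sorted_list_of_set (props C)) Cs)) Leaf"

lemma call_main:
  assumes "11 * B + 6 < d"
  shows "calls Ops d 0 [Node (enc_list (map (enc_cgs AP) Ps)) (enc_list (map (enc_cgs AP) Ns))]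
    = Some (enc_bool (\<exists>v\<in>elems n ((round Ops Cs k ^^ (2 ^ n)) atoms). check Ps Ns v))"
proof -
  obtain d' where [simp]: "d = Suc d'" using assms by (cases d) auto
  let ?m = "prop_vec AP Cs 0"
  have m: "length ?m = n" by (simp add: prop_vec_def)
  have 1: "calls Ops d' 27 [enc_list (map (enc_cgs AP) Ps), enc_list (map (enc_cgs AP) Ns)] = Some enc_Cs"
    using call_append[of "map (enc_cgs AP) Ps" d' Ops] length_le assms by simp
  have 2: "calls Ops d' 11 [Leaf, Leaf, enc_Cs] = Some (enc_vec ?m)"
    using call_prop_Cs[of 0 d'] assms by simp
  \<comment> \<open>On an empty sample \<open>left (left Leaf)\<close> is \<open>Leaf\<close>, the
    encoding of 0; this is where \<open>k_eq\<close> enters.\<close>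
  have 3: "left (left enc_Cs) = enc_nat k"
  proof (cases Cs)
    case Nil
    then show ?thesis using k_eq by simp
  next
    case (Cons C _)
    then have "nagents C = k" using bounded by (auto simp: bounded_cgs_def)
    with Cons show ?thesis by simp
  qed
  have 4: "calls Ops d' 21 [Leaf, Leaf, enc_Cs, enc_Cs] = Some atoms"
    using call_atoms[of "[]" Cs d' Leaf] props_le length_le assms unfolding atoms_def by simp
  have 5: "calls Ops d' 20 [enc_vec ?m, T, enc_Cs, enc_vec ?m, enc_nat k]
      = Some ((round Ops Cs k ^^ (2 ^ n)) T)" for T
    using call_rounds[OF m, of ?m d' T] m positions_le assms by simp
  have 6: "calls Ops d' 26 [enc_vec ?m, Leaf, T, enc_list (map (enc_cgs AP) Ps),
      enc_list (map (enc_cgs AP) Ns)] = Some (enc_bool (\<exists>v\<in>elems n T. check Ps Ns v))" for T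
    using call_search[of "[]" ?m d' T] m positions_le assms by (simp add: elems_def Bex_def conj_assoc)
  show ?thesis
    by (simp add: program_simps main_body_def 1 2 3 4 5 6 del: map_append)
qed

end

section \<open>Samples as bounded instances, and the decision result\<close>

lemma bounded_cgsI:
  assumes C: "is_cgs C" "cgs_size C \<le> B"
  shows "bounded_cgs (nagents C) B C"
  unfolding bounded_cgs_def
proof (intro conjI ballI)
  have size: "card (Q_Act C) \<le> B" "card (props C) \<le> B" using C(2) by (simp_all add: cgs_size_def)
  show "card (states C) \<le> B" using card_states_le[OF C(1)] size by simp
  fix q assume q: "q \<in> states C"
  then show "length (moves_list C q) \<le> B"
    using card_moves_le[OF C(1) q] size by (simp add: length_moves_list)
  have "label C q \<subseteq> props C" "finite (props C)" using C(1) q by (auto simp: is_cgs_def)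
  then show "card (label C q) \<le> B" using card_mono[of "props C" "label C q"] size by simp
  fix \<alpha> x assume "\<alpha> \<in> moves C q" "x \<in> set \<alpha>"
  from action_le[OF C(1) q this] card_moves_le[OF C(1) q] size show "x \<le> B" by simp
qed (use C in simp_all)

lemma sample_props_le:
  assumes S: "is_sample S"
  shows "finite (sample_props S)" "card (sample_props S) \<le> sample_size S"
proof -
  have "\<forall>C\<in>all_cgs S. finite (props C)" using S by (simp add: is_sample_def is_cgs_def)
  then show "finite (sample_props S)" using finite_all_cgs[OF S] by (simp add: sample_props_def)
  have "card (sample_props S) \<le> (\<Sum>C\<in>all_cgs S. card (props C))"
    unfolding sample_props_def using finite_all_cgs[OF S] by (rule card_UN_le)
  also have "\<dots> \<le> sample_size S" unfolding sample_size_def by (rule sum_mono) (simp add: cgs_size_def)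
  finally show "card (sample_props S) \<le> sample_size S" .
qed

lemma sample_agents_eq:
  assumes S: "is_sample S" and C: "C \<in> all_cgs S"
  shows "sample_agents S = {1..nagents C}" "\<And>D. D \<in> all_cgs S \<Longrightarrow> nagents D = nagents C"
proof -
  have eq: "agents D = agents C" if "D \<in> all_cgs S" for D using S C that unfolding is_sample_def by blast
  show "nagents D = nagents C" if "D \<in> all_cgs S" for D
    using arg_cong[OF eq[OF that], of card] by (simp add: agents_def)
  show "sample_agents S = {1..nagents C}"
    unfolding sample_agents_def agents_def[of C, symmetric] using eq C by blast
qed

lemma length_positions: "length (positions Cs) = sum_list (map (\<lambda>C. card (states C)) Cs)"
  by (induction Cs) simp_all

lemma bounded_instance_of_sample:
  assumes S: "is_sample S" "S = (set Ps, set Ns)" "distinct Ps" "distinct Ns"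
  shows "bounded_instance (sample_props S) Ps Ns (card (sample_agents S)) (2 * (sample_size S + 1))"
    (is "bounded_instance ?AP Ps Ns ?k ?B")
proof
  have sub: "set Ps \<subseteq> all_cgs S" "set Ns \<subseteq> all_cgs S" "all_cgs S = set (Ps @ Ns)"
    using S(2) by auto
  have cgs: "is_cgs C" if "C \<in> set (Ps @ Ns)" for C using S(1) sub(3) that by (simp add: is_sample_def)
  have k: "nagents C = ?k" if "C \<in> set (Ps @ Ns)" for C
    using sample_agents_eq(1)[OF S(1)] that sub(3) by simp
  have B: "cgs_size C \<le> sample_size S" if "C \<in> set (Ps @ Ns)" for C
    using cgs_size_le[OF S(1)] that sub(3) by simp
  show "\<forall>C\<in>set (Ps @ Ns). bounded_cgs ?k ?B C"
    using bounded_cgsI[of _ ?B] cgs B k by (metis Suc_eq_plus1 le_SucI mult_2 trans_le_add1)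
  \<comment> \<open>Each list alone is free of repetitions and stays within the size of the sample;
    a structure in both lists counts twice.\<close>
  have half: "sum_list (map f Ps) \<le> sample_size S" "sum_list (map f Ns) \<le> sample_size S"
    if "\<And>C. C \<in> set (Ps @ Ns) \<Longrightarrow> f C \<le> cgs_size C" for f
    using that S(3,4) sub(1,2) by (auto intro!: sum_list_le_sample_size[OF S(1)])
  have "card (states C) \<le> cgs_size C" if "C \<in> set (Ps @ Ns)" for C
    using card_states_le[OF cgs[OF that]] by (simp add: cgs_size_def)
  from half[of "\<lambda>C. card (states C)", OF this] show "length (positions (Ps @ Ns)) \<le> ?B"
    unfolding length_positions by simp
  show "length (Ps @ Ns) \<le> ?B"
    using length_le_sample_size[OF S(1) S(3) sub(1)] length_le_sample_size[OF S(1) S(4) sub(2)] by simp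
  show "Ps @ Ns = [] \<Longrightarrow> ?k = 0" using sub(3) by (simp add: sample_agents_def)
  show "?k \<le> ?B"
  proof (cases "Ps @ Ns")
    case Nil
    then show ?thesis using sub(3) by (simp add: sample_agents_def)
  next
    case (Cons C _)
    then have C: "C \<in> set (Ps @ Ns)" by simp
    have "?k \<le> cgs_size C" using k[OF C] by (simp add: cgs_size_def agents_def)
    with B[OF C] show ?thesis by simp
  qed
  show "finite ?AP" "card ?AP \<le> ?B" using sample_props_le[OF S(1)] by simp_all
  show "\<forall>C\<in>set (Ps @ Ns). props C \<subseteq> ?AP" unfolding sample_props_def sub(3) by blast
  have "card (props C) \<le> cgs_size C" for C by (simp add: cgs_size_def)
  from half[of "\<lambda>C. card (props C)", OF this]
  show "length (concat (map (\<lambda>C. sorted_list_of_set (props C)) (Ps @ Ns))) \<le> ?B"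
    by (simp add: length_concat comp_def)
qed

lemma atoms_elems:
  assumes "bounded_instance AP Ps Ns k B"
  shows "elems (length (positions (Ps @ Ns))) (bounded_instance.atoms AP Ps Ns) =
    (\<lambda>p. prop_vec AP (Ps @ Ns) (rank AP p)) ` (\<Union>C\<in>set (Ps @ Ns). props C)"
proof -
  interpret bounded_instance undefined AP Ps Ns k B by (rule assms)
  have fin: "finite (props C)" if "C \<in> set Cs" for C
    using AP(1,3) that finite_subset by blast
  have "atoms = fold insert_trie (map (\<lambda>p. prop_vec AP Cs (rank AP p))
      (concat (map (\<lambda>C. sorted_list_of_set (props C)) Cs))) Leaf"
    unfolding atoms_def fold_map comp_def ..
  then have "elems n atoms = (\<lambda>p. prop_vec AP Cs (rank AP p)) `
      set (concat (map (\<lambda>C. sorted_list_of_set (props C)) Cs)) \<union> elems n Leaf"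
    by (simp only: set_map) (subst elems_fold_insert_trie, auto simp: prop_vec_def)
  also have "set (concat (map (\<lambda>C. sorted_list_of_set (props C)) Cs)) = (\<Union>C\<in>set Cs. props C)"
    using fin by auto
  also have "elems n Leaf = {}" by (simp add: elems_def not_in_trie_Leaf)
  finally show ?thesis by simp
qed

text \<open>The satisfaction vectors of all formulas form the least closed set above those of the
  propositions: closure builds a formula from two given ones, and leastness is induction on
  formulas.\<close>

lemma saturation_eq:
  assumes S: "is_sample S" "S = (set Ps, set Ns)" "distinct Ps" "distinct Ns"
  defines "Cs \<equiv> Ps @ Ns"
  defines "n \<equiv> length (positions Cs)"
  shows "elems n ((round Ops Cs (card (sample_agents S)) ^^ (2 ^ n))
      (bounded_instance.atoms (sample_props S) Ps Ns)) = sat_vec Cs ` sample_ATL Ops S"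
  unfolding n_def
proof (rule rounds_reach_fixpoint)
  let ?AP = "sample_props S" and ?Ag = "sample_agents S"
  let ?k = "card ?Ag" and ?F = "sat_vec Cs ` sample_ATL Ops S"
  note inst = bounded_instance_of_sample[OF S]
  have all: "all_cgs S = set Cs" using S(2) by (simp add: Cs_def)
  have cgs: "\<forall>C\<in>set Cs. is_cgs C" using S(1) all by (simp add: is_sample_def)
  have k: "\<forall>C\<in>set Cs. nagents C = ?k"
    using sample_agents_eq(1)[OF S(1)] all by simp
  have Ag: "?Ag = {1..?k}"
  proof (cases "all_cgs S = {}")
    case False
    then obtain C where "C \<in> all_cgs S" by blast
    with sample_agents_eq(1)[OF S(1)] show ?thesis by simp
  qed (simp add: sample_agents_def)
  have AP: "finite ?AP" "\<forall>C\<in>set Cs. is_cgs C \<and> props C \<subseteq> ?AP" "?AP = (\<Union>C\<in>set Cs. props C)"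
    using sample_props_le(1)[OF S(1)] cgs all by (auto simp: sample_props_def)
  have atoms: "elems (length (positions Cs)) (bounded_instance.atoms ?AP Ps Ns) = (\<lambda>p. sat_vec Cs (Prop p)) ` ?AP"
    unfolding Cs_def atoms_elems[OF inst] unfolding Cs_def[symmetric] AP(3)[symmetric]
    using sat_vec_Prop[OF AP(1) _ AP(2)] by simp
  show "elems (length (positions Cs)) (bounded_instance.atoms ?AP Ps Ns) \<subseteq> ?F"
    unfolding atoms sample_ATL_def by (auto intro: ATL.intros)
  show "set (operator_results Ops Cs As v w) \<subseteq> ?F"
    if "v \<in> ?F" "w \<in> ?F" "length As = ?k" for v w As
  proof -
    from that obtain \<Phi> \<Psi> where \<Phi>: "v = sat_vec Cs \<Phi>" "\<Phi> \<in> sample_ATL Ops S"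
      and \<Psi>: "w = sat_vec Cs \<Psi>" "\<Psi> \<in> sample_ATL Ops S" by blast
    have "coalition_of As \<subseteq> ?Ag" using coalition_of_subset[OF that(3)] Ag by simp
    moreover have "\<forall>C\<in>set Cs. nagents C = length As" using k that(3) by simp
    ultimately show ?thesis using \<Phi>(2) \<Psi>(2) unfolding \<Phi>(1) \<Psi>(1) sample_ATL_def
      by (auto simp: operator_results_def sat_vec_Neg sat_vec_Conj sat_vec_Enf[OF cgs]
          split: if_splits intro!: imageI ATL.intros)
  qed
  show "?F \<subseteq> X" if base: "elems (length (positions Cs)) (bounded_instance.atoms ?AP Ps Ns) \<subseteq> X"
    and closed: "\<And>v w As. v \<in> X \<Longrightarrow> w \<in> X \<Longrightarrow> length As = ?k \<Longrightarrow>
      set (operator_results Ops Cs As v w) \<subseteq> X" for X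
  proof -
    have "sat_vec Cs \<Phi> \<in> X" if "\<Phi> \<in> ATL Ops ?Ag ?AP" for \<Phi>
      using that
    proof induction
      case (1 p)
      then show ?case using base atoms by blast
    next
      case (2 \<Phi>)
      \<comment> \<open>Negation is available under every coalition; the empty one is
        picked.\<close>
      with closed[of "sat_vec Cs \<Phi>" "sat_vec Cs \<Phi>" "replicate ?k False"] show ?case
        by (simp add: operator_results_def sat_vec_Neg)
    next
      case (3 \<Phi> \<Psi>)
      with closed[of "sat_vec Cs \<Phi>" "sat_vec Cs \<Psi>" "replicate ?k False"] show ?case
        by (simp add: operator_results_def sat_vec_Conj)
    next
      case (4 A \<Phi>)
      with Ag obtain As where As: "length As = ?k" "coalition_of As = A"
        using ex_coalition_of by metis
      with closed[of "sat_vec Cs \<Phi>" "sat_vec Cs \<Phi>" As] 4 k show ?case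
        by (simp add: operator_results_def sat_vec_Enf[OF cgs])
    next
      case (5 A \<Phi>)
      with Ag obtain As where As: "length As = ?k" "coalition_of As = A"
        using ex_coalition_of by metis
      with closed[of "sat_vec Cs \<Phi>" "sat_vec Cs \<Phi>" As] 5 k show ?case
        by (simp add: operator_results_def sat_vec_Enf[OF cgs])
    next
      case (6 A \<Phi> \<Psi>)
      with Ag obtain As where As: "length As = ?k" "coalition_of As = A"
        using ex_coalition_of by metis
      with closed[of "sat_vec Cs \<Phi>" "sat_vec Cs \<Psi>" As] 6 k show ?case
        by (simp add: operator_results_def sat_vec_Enf[OF cgs])
    qed
    then show ?thesis unfolding sample_ATL_def by blast
  qed
qed

text \<open>With \<open>B = 2 * (sample_size S + 1)\<close> the depth bound
  \<open>11 * B + 6\<close> of \<open>call_main\<close> is at most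
  \<open>28 * (sample_size S + 1)\<close>, so the factor 50 leaves room.\<close>

lemma program_correct:
  assumes S: "is_sample S" and w: "encodes_sample S w"
  shows "calls Ops (50 * (sample_size S + 1)) 0 [w] =
    Some (enc_bool (\<exists>\<Phi>\<in>sample_ATL Ops S. consistent \<Phi> S))"
proof -
  from w obtain Ps Ns where PN: "S = (set Ps, set Ns)" "distinct Ps" "distinct Ns"
    and w: "w = Node (enc_list (map (enc_cgs (sample_props S)) Ps))
      (enc_list (map (enc_cgs (sample_props S)) Ns))"
    unfolding encodes_sample_def by blast
  have cgs: "\<forall>C\<in>set (Ps @ Ns). is_cgs C" using S by (auto simp: PN(1) is_sample_def)
  note inst = bounded_instance_of_sample[OF S PN]
  have "calls Ops (50 * (sample_size S + 1)) 0 [w] =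
    Some (enc_bool (\<exists>v\<in>sat_vec (Ps @ Ns) ` sample_ATL Ops S. check Ps Ns v))"
    unfolding w saturation_eq[OF S PN, of Ops, symmetric]
    by (rule bounded_instance.call_main[OF inst]) simp
  then show ?thesis using check_sat_vec[OF cgs] PN(1) by simp
qed

theorem theorem2:
  fixes Ops :: "atl_op set"
  shows "decidable_in_exp_time is_sample encodes_sample sample_size
           (\<lambda>S. \<exists>\<Phi>\<in>sample_ATL Ops S. consistent \<Phi> S)
       \<and> (\<forall>S. is_sample S \<and> (\<exists>\<Phi>\<in>sample_ATL Ops S. consistent \<Phi> S) \<longrightarrow>
              (\<exists>\<Phi>\<in>sample_ATL Ops S. consistent \<Phi> S \<and>
                 formula_size \<Phi> \<le> 2 ^ card (sample_states S)))"
proof (intro conjI allI impI)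
  show "decidable_in_exp_time is_sample encodes_sample sample_size
      (\<lambda>S. \<exists>\<Phi>\<in>sample_ATL Ops S. consistent \<Phi> S)"
    by (rule decidable_in_exp_timeI[where prog = "program Ops" and c = 50]) (rule program_correct)
  fix S assume "is_sample S \<and> (\<exists>\<Phi>\<in>sample_ATL Ops S. consistent \<Phi> S)"
  then obtain \<Phi> where S: "is_sample S" and \<Phi>: "\<Phi> \<in> sample_ATL Ops S" "consistent \<Phi> S" by blast
  from small_formula[OF S \<Phi>(1)] consistent_cong[OF S] \<Phi>(2)
  show "\<exists>\<Phi>\<in>sample_ATL Ops S. consistent \<Phi> S \<and> formula_size \<Phi> \<le> 2 ^ card (sample_states S)"
    by blast
qed

end
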